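(* Let $K_n$ be the complete directed graph on $n$ vertices whose edge weights are independent and uniformly distributed on $[0,1]$, and let $\mathcal{LSP}$ be the set of locally shortest paths in it. Then $\mathbb{E}[|\mathcal{LSP}|]=\Theta(n^2)$.
   Context: Shortest paths are unique with probability 1. For vertices $u,v$, $u\rightsquigarrow v$ denotes the unique shortest path from $u$ to $v$ (empty if $u=v$). A path is a locally shortest path (LSP) if the path obtained by deleting its first edge and the path obtained by deleting its last edge are both shortest paths (empty paths count as shortest paths; in particular every single edge is an LSP). *)

theory Defs
  imports
    "HOL-Probability.Probability"
    "HOL-Library.Landau_Symbols"
    "Graph_Theory.Graph_Theory"
    "Graph_Theory.Kuratowski"
begin

definition complete_dgraph :: "nat \<Rightarrow> (nat, nat \<times> nat) pre_digraph" where
  "complete_dgraph n =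
     \<lparr> verts = {..<n},
       arcs = {(u, v). u < n \<and> v < n \<and> u \<noteq> v},
       tail = fst, head = snd \<rparr>"

lemma complete_digraph_complete_dgraph: "complete_digraph n (complete_dgraph n)"
proof -
  have "finite {(u, v). u < n \<and> v < n \<and> u \<noteq> v}"
    by (rule finite_subset[of _ "{..<n} \<times> {..<n}"]) auto
  then have "graph (complete_dgraph n)"
    by unfold_locales
      (auto simp: complete_dgraph_def arc_to_ends_def arcs_ends_def symmetric_def sym_def image_iff)
  then show ?thesis
    by (auto simp: complete_digraph_def complete_dgraph_def arcs_ends_def arc_to_ends_def)
qed

context wf_digraph
begin

text \<open>Paths are lists of arcs that do not repeat a vertex; the empty path at a vertex
  is its own only competitor and hence a shortest path.\<close>

definition shortest_path :: "'b weight_fun \<Rightarrow> 'a \<Rightarrow> 'b awalk \<Rightarrow> 'a \<Rightarrow> bool" where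
  "shortest_path w u p v \<longleftrightarrow> is_arg_min (awalk_cost w) (\<lambda>q. apath u q v) p"

text \<open>The condition \<open>p \<noteq> []\<close> is there because an empty path has no first or last edge to delete.
  It also makes the list of arcs determine the two end points, so that locally shortest
  paths can be counted as lists of arcs.\<close>

definition locally_shortest_path :: "'b weight_fun \<Rightarrow> 'a \<Rightarrow> 'b awalk \<Rightarrow> 'a \<Rightarrow> bool" where
  "locally_shortest_path w u p v \<longleftrightarrow>
     p \<noteq> [] \<and> apath u p v \<and>
     shortest_path w (head G (hd p)) (tl p) v \<and>
     shortest_path w u (butlast p) (tail G (last p))"

definition LSP :: "'b weight_fun \<Rightarrow> 'b awalk set" where
  "LSP w = {p. \<exists>u v. locally_shortest_path w u p v}"

lemma shortest_path_Nil: "u \<in> verts G \<Longrightarrow> shortest_path w u [] u"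
  by (auto simp: shortest_path_def is_arg_min_def apath_Nil_iff dest: apath_nonempty_ends)

lemma single_arc_in_LSP:
  assumes "e \<in> arcs G" "tail G e \<noteq> head G e"
  shows "[e] \<in> LSP w"
proof -
  have "locally_shortest_path w (tail G e) [e] (head G e)"
    using assms by (auto simp: locally_shortest_path_def apath_simps intro: shortest_path_Nil)
  then show ?thesis by (auto simp: LSP_def)
qed

end

end

theory Submission
  imports Defs "HOL-Real_Asymp.Real_Asymp"
begin

text \<open>Every arc is a locally shortest path, which gives the lower bound. For the upper bound, a
  longer locally shortest path consists of an arc \<open>(a, b)\<close>, a shortest path from \<open>b\<close> to \<open>c\<close>, and an
  arc \<open>(c, d)\<close>, where \<open>d\<close> is a child of \<open>c\<close> in the tree of shortest paths from \<open>b\<close>, and \<open>a\<close> is a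
  child of \<open>b\<close> in the tree of shortest paths to \<open>c\<close>. As \<open>x * y \<le> x\<^sup>2 + y\<^sup>2\<close> and reversing all
  arcs preserves the distribution, it suffices that the expected sum of the squared numbers of
  children in a shortest path tree with root \<open>b\<close> is linear in \<open>n\<close>, up to an exponentially small
  multiple of \<open>n\<^sup>3\<close>. Let \<open>T d\<close> denote the distance from \<open>b\<close> to \<open>d\<close>. Resampling a single weight
  shows two things.

  \<^item> The mean of the positive part of \<open>T d - T c\<close> is at most the probability that \<open>d\<close> is a child
  of \<open>c\<close>. Summing over \<open>c\<close> and \<open>d\<close>, the total mean delay is at most \<open>n\<close>.

  \<^item> The probability that \<open>d\<close> and \<open>d'\<close> are both children of \<open>c\<close>, with \<open>(c, d)\<close> the lighter arc and
  of weight at most \<open>1 / 2\<close>, is at most eight times the mean of the positive part of \<open>T d' - T d\<close> on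
  the event that \<open>d\<close> is a child of \<open>c\<close>. Summing over \<open>c\<close>, \<open>d\<close> and \<open>d'\<close>, the expected number of
  such sibling pairs is at most \<open>8 * n\<close>.

  Arcs of weight more than \<open>1 / 2\<close> lie on a shortest path with exponentially small probability only,
  because all detours via one further vertex would have to be long.\<close>

section \<open>Distances and shortest path trees\<close>

locale complete_network =
  fixes n :: nat
begin

sublocale fin_digraph "complete_dgraph n"
proof -
  interpret graph "complete_dgraph n"
    using complete_digraph_complete_dgraph by (simp add: complete_digraph_def)
  show "fin_digraph (complete_dgraph n)"
    by unfold_locales
qed

abbreviation "E \<equiv> arcs (complete_dgraph n)"

lemma arc_iff [simp]: "(u, v) \<in> E \<longleftrightarrow> u < n \<and> v < n \<and> u \<noteq> v"
  and verts_iff [simp]: "u \<in> verts (complete_dgraph n) \<longleftrightarrow> u < n"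
  and tail_eq [simp]: "tail (complete_dgraph n) = fst"
  and head_eq [simp]: "head (complete_dgraph n) = snd"
  by (auto simp: complete_dgraph_def)

definition nonneg :: "(nat \<times> nat \<Rightarrow> real) \<Rightarrow> bool" where
  "nonneg w \<longleftrightarrow> (\<forall>e\<in>E. 0 \<le> w e)"

text \<open>The minimum runs over the finite set of simple paths, which is nonempty for
  \<open>u, v < n\<close>; for other vertices the value carries no information.\<close>

definition spd :: "(nat \<times> nat \<Rightarrow> real) \<Rightarrow> nat \<Rightarrow> nat \<Rightarrow> real" where
  "spd w u v = Min (awalk_cost w ` {p. apath u p v})"

lemma apath_vertices: "apath u p v \<Longrightarrow> u < n \<and> v < n"
  unfolding apath_def by (metis awalk_hd_in_verts awalk_last_in_verts verts_iff)

lemma apath_exists: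
  assumes "u < n" "v < n" shows "\<exists>p. apath u p v"
proof (cases "u = v")
  case True
  then show ?thesis using assms by (intro exI[of _ "[]"]) (simp add: apath_Nil_iff)
next
  case False
  then show ?thesis using assms by (intro exI[of _ "[(u, v)]"]) (simp add: apath_simps)
qed

lemma spd_le: "apath u p v \<Longrightarrow> spd w u v \<le> awalk_cost w p"
  unfolding spd_def by (intro Min_le finite_imageI apaths_finite) auto

lemma spd_attained:
  assumes "u < n" "v < n"
  obtains p where "apath u p v" "awalk_cost w p = spd w u v"
proof -
  have "spd w u v \<in> awalk_cost w ` {p. apath u p v}"
    unfolding spd_def using apath_exists[OF assms]
    by (intro Min_in finite_imageI apaths_finite) auto
  then show ?thesis using that by auto
qed

lemma awalk_cost_nonneg: "nonneg w \<Longrightarrow> awalk u p v \<Longrightarrow> 0 \<le> awalk_cost w p"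
  by (rule pos_cost_pos_awalk_cost) (auto simp: nonneg_def)

text \<open>Removing cycles turns a walk into a simple path, and with nonnegative weights this does
  not raise the cost.\<close>

lemma spd_le_awalk:
  assumes "nonneg w" "awalk u p v" shows "spd w u v \<le> awalk_cost w p"
proof -
  have "awalk_cost w (awalk_to_apath p) \<le> awalk_cost w p"
    using assms awalk_cost_nonneg[OF assms(1)]
    by (intro awalk_to_path_no_neg_cyc_cost) (auto simp: not_less)
  with spd_le[OF apath_awalk_to_apath[OF assms(2)], of w] show ?thesis by simp
qed

lemma awalk_cost_cong:
  "awalk u p v \<Longrightarrow> (\<And>e. e \<in> E \<Longrightarrow> w e = w' e) \<Longrightarrow> awalk_cost w p = awalk_cost w' p"
  unfolding awalk_cost_def awalk_def by (intro arg_cong[of _ _ sum_list] map_cong) auto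

lemma awalk_cost_upd [simp]: "e \<notin> set p \<Longrightarrow> awalk_cost (w(e := t)) p = awalk_cost w p"
  by (induction p) auto

lemma apath_arc_from_end_notin: "apath u p v \<Longrightarrow> (v, x) \<notin> set p"
proof (induction p arbitrary: u)
  case (Cons e p)
  then have "v \<in> set (awalk_verts (snd e) p)" "fst e \<notin> set (awalk_verts (snd e) p)"
    by (auto simp: apath_Cons_iff apath_def)
  with Cons show ?case by (auto simp: apath_Cons_iff)
qed simp

text \<open>A simple path visits its last vertex only once, so no path to \<open>c\<close> uses an
  arc out of \<open>c\<close>. Hence the distance to \<open>c\<close> stays fixed while the weight
  of \<open>(c, d)\<close> is resampled.\<close>

lemma spd_upd_tail [simp]: "spd (w((c, d) := t)) u c = spd w u c"
  unfolding spd_def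
  by (intro arg_cong[of _ _ Min] image_cong) (auto simp: apath_arc_from_end_notin)

lemma spd_triangle:
  assumes "nonneg w" "u < n" "(c, d) \<in> E"
  shows "spd w u d \<le> spd w u c + w (c, d)"
proof -
  obtain p where p: "apath u p c" "awalk_cost w p = spd w u c"
    using spd_attained assms by (metis arc_iff)
  have "awalk u (p @ [(c, d)]) d"
    using p assms(3) by (auto simp: apath_def awalk_simps dest: awalk_ends_eqD)
  from spd_le_awalk[OF assms(1) this] p show ?thesis by simp
qed

text \<open>A shortest path that is cheaper than the detour through an arc does not use that arc,
  hence it survives any change of the weight of the arc.\<close>

lemma spd_upd_le:
  assumes "nonneg w" "u < n" "v < n" "(c, d) \<in> E"
    and less: "spd w u v < spd w u c + w (c, d)"
  shows "spd (w((c, d) := t)) u v \<le> spd w u v"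
proof -
  obtain p where p: "apath u p v" "awalk_cost w p = spd w u v"
    using spd_attained assms by metis
  have "(c, d) \<notin> set p"
  proof
    assume "(c, d) \<in> set p"
    then obtain q r where pqr: "p = q @ (c, d) # r" by (meson split_list)
    with p have "awalk u q c" "awalk d r v"
      by (auto simp: apath_def awalk_Cons_iff)
    with assms(1) have "spd w u c \<le> awalk_cost w q" "0 \<le> awalk_cost w r"
      by (auto intro: spd_le_awalk awalk_cost_nonneg)
    with p pqr less show False by simp
  qed
  with spd_le[OF p(1), of "w((c, d) := t)"] p show ?thesis by simp
qed

section \<open>Reversal of all arcs\<close>

text \<open>The vertex lists are tracked because \<open>apath_rev\<close> needs the distinctness of
  the reversed vertices.\<close>

lemma awalk_verts_rev:
  "awalk u p v \<Longrightarrow> awalk v (rev (map prod.swap p)) u \<and>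
     awalk_verts v (rev (map prod.swap p)) = rev (awalk_verts u p)"
proof (induction p arbitrary: u)
  case Nil
  then show ?case by (auto simp: awalk_Nil_iff)
next
  case (Cons e p)
  obtain a b where e: "e = (a, b)" by force
  with Cons.prems have p: "awalk b p v" and ab: "u = a" "a < n" "b < n" "a \<noteq> b"
    by (auto simp: awalk_Cons_iff)
  from Cons.IH[OF p] have IH: "awalk v (rev (map prod.swap p)) b"
    "awalk_verts v (rev (map prod.swap p)) = rev (awalk_verts b p)" by auto
  have w: "awalk v (rev (map prod.swap p) @ [(b, a)]) a"
    using IH(1) awlast_of_awalk[OF IH(1)] ab by (simp add: awalk_simps)
  have "awalk_verts v (rev (map prod.swap p) @ [(b, a)]) = rev (awalk_verts b p) @ [a]"
    using awalk_verts_append[OF w] awlast_of_awalk[OF IH(1)] IH(2) by simp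
  with w ab e show ?case by simp
qed

lemma apath_rev: "apath u p v \<Longrightarrow> apath v (rev (map prod.swap p)) u"
  using awalk_verts_rev by (auto simp: apath_def)

lemma awalk_cost_rev: "awalk_cost (w \<circ> prod.swap) (rev (map prod.swap p)) = awalk_cost w p"
  by (simp add: awalk_cost_def rev_map [symmetric] comp_def sum_list_rev)

lemma spd_swap: "spd (w \<circ> prod.swap) v u = spd w u v"
proof -
  have "{p. apath v p u} = (\<lambda>p. rev (map prod.swap p)) ` {p. apath u p v}" (is "?L = ?f ` ?R")
  proof (intro equalityI subsetI)
    fix p assume "p \<in> ?L"
    then have "?f p \<in> ?R" using apath_rev by blast
    moreover have "p = ?f (?f p)" by (simp add: rev_map comp_def)
    ultimately show "p \<in> ?f ` ?R" by blast
  qed (auto intro: apath_rev)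
  then show ?thesis by (simp add: spd_def image_image awalk_cost_rev)
qed

section \<open>Children and parents in shortest path trees\<close>

text \<open>For generic weights these are the children of \<open>c\<close> in the tree of shortest paths from \<open>b\<close>.\<close>

definition children :: "(nat \<times> nat \<Rightarrow> real) \<Rightarrow> nat \<Rightarrow> nat \<Rightarrow> nat set" where
  "children w b c = {d. d < n \<and> d \<noteq> b \<and> d \<noteq> c \<and> spd w b d = spd w b c + w (c, d)}"

text \<open>Distinct costs are demanded of all simple paths with common ends, which is more than
  uniqueness of shortest paths. In this form the property is a finite conjunction of comparisons
  between fixed paths.\<close>

definition generic :: "(nat \<times> nat \<Rightarrow> real) \<Rightarrow> bool" where
  "generic w \<longleftrightarrow> (\<forall>e\<in>E. 0 < w e) \<and>
     (\<forall>u v p q. apath u p v \<longrightarrow> apath u q v \<longrightarrow> awalk_cost w p = awalk_cost w q \<longrightarrow> p = q)"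

lemma generic_nonneg: "generic w \<Longrightarrow> nonneg w"
  by (auto simp: generic_def nonneg_def less_imp_le)

text \<open>If \<open>d\<close> were already on the shortest path to \<open>c\<close>, it would be
  no farther from \<open>b\<close> than \<open>c\<close> is, although \<open>(c, d)\<close> has
  positive weight.\<close>

lemma apath_snoc_child:
  assumes "generic w" "b < n" "c < n" "d \<in> children w b c"
    and p: "apath b p c" "awalk_cost w p = spd w b c"
  shows "apath b (p @ [(c, d)]) d"
proof -
  have cd: "d < n" "d \<noteq> c" "spd w b d = spd w b c + w (c, d)"
    using assms by (auto simp: children_def)
  have last: "awlast b p = c" and walk: "awalk b p c"
    using p by (auto simp: apath_def)
  have "d \<notin> set (awalk_verts b p)"
  proof
    assume "d \<in> set (awalk_verts b p)"
    from awalk_decomp[OF walk this] obtain q r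
      where "p = q @ r" "awalk b q d" "awalk d r c" by metis
    with generic_nonneg[OF assms(1)] have "spd w b d \<le> awalk_cost w p"
      by (metis add.right_neutral add_mono awalk_cost_append awalk_cost_nonneg spd_le_awalk)
    moreover have "0 < w (c, d)" using assms cd by (auto simp: generic_def)
    ultimately show False using p cd by simp
  qed
  then show ?thesis using p cd assms(3) last by (simp add: apath_append_iff apath_simps)
qed

text \<open>Two parents give two simple paths to \<open>d\<close> of the same cost; genericity
  identifies these paths, and with them their last arcs.\<close>

lemma parent_unique:
  assumes "generic w" "b < n" "c < n" "c' < n"
    and d: "d \<in> children w b c" "d \<in> children w b c'"
  shows "c = c'"
proof -
  obtain p p' where p: "apath b p c" "awalk_cost w p = spd w b c"
    and p': "apath b p' c'" "awalk_cost w p' = spd w b c'"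
    using spd_attained assms by metis
  have "awalk_cost w (p @ [(c, d)]) = awalk_cost w (p' @ [(c', d)])"
    using p p' d by (simp add: children_def)
  with apath_snoc_child[OF assms(1,2,3) d(1) p] apath_snoc_child[OF assms(1,2,4) d(2) p']
  have "p @ [(c, d)] = p' @ [(c', d)]"
    using assms(1) unfolding generic_def by blast
  then show ?thesis by simp
qed

section \<open>Decomposing and counting locally shortest paths\<close>

lemma shortest_path_iff:
  "shortest_path w u p v \<longleftrightarrow> apath u p v \<and> awalk_cost w p = spd w u v"
proof
  assume *: "shortest_path w u p v"
  then have "apath u p v" by (simp add: shortest_path_def is_arg_min_def)
  moreover from this obtain q where "apath u q v" "awalk_cost w q = spd w u v"
    using spd_attained apath_vertices by metis
  ultimately show "apath u p v \<and> awalk_cost w p = spd w u v"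
    using * spd_le[of u p v w] by (auto simp: shortest_path_def is_arg_min_def)
next
  assume "apath u p v \<and> awalk_cost w p = spd w u v"
  then show "shortest_path w u p v"
    using spd_le by (fastforce simp: shortest_path_def is_arg_min_def not_less)
qed

lemma finite_LSP: "finite (LSP w)"
proof (rule finite_subset)
  show "LSP w \<subseteq> (\<Union>u<n. \<Union>v<n. {p. apath u p v})"
    using apath_vertices by (fastforce simp: LSP_def locally_shortest_path_def)
qed (auto intro: apaths_finite)

lemma card_LSP_ge: "n * (n - 1) \<le> card (LSP w)"
proof -
  have "(\<lambda>e. [e]) ` (SIGMA u:{..<n}. {..<n} - {u}) \<subseteq> LSP w"
    by (auto intro!: single_arc_in_LSP)
  then have "card ((\<lambda>e. [e]) ` (SIGMA u:{..<n}. {..<n} - {u})) \<le> card (LSP w)"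
    by (rule card_mono[OF finite_LSP])
  then show ?thesis by (simp add: card_image inj_on_def)
qed

text \<open>Random weights are given on all pairs, whereas the product measure lives on functions
  restricted to \<open>E\<close>; this lemma connects the two.\<close>

lemma LSP_cong:
  assumes "\<And>e. e \<in> E \<Longrightarrow> w e = w' e" shows "LSP w = LSP w'"
proof -
  have *: "spd w u v = spd w' u v" for u v
    unfolding spd_def
    by (intro arg_cong[of _ _ Min] image_cong awalk_cost_cong[OF _ assms]) (auto simp: apath_def)
  have **: "shortest_path w = shortest_path w'"
    by (auto simp: fun_eq_iff shortest_path_iff * apath_def awalk_cost_cong[OF _ assms])
  then show ?thesis by (simp add: LSP_def locally_shortest_path_def)
qed

text \<open>With single arcs excluded, the first and the last arc are different entries of
  \<open>p\<close>; \<open>q\<close> may be empty, and then \<open>b = c\<close>. Minimality of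
  \<open>q @ [(c, d)]\<close> and the triangle inequality force
  \<open>spd w b d = spd w b c + w (c, d)\<close>. The first arc is treated in the same way in the
  reversed network.\<close>

lemma LSP_long_decomp:
  assumes w: "nonneg w" and p: "locally_shortest_path w u p v" and len: "length p \<noteq> 1"
  obtains a b c d q where "p = (a, b) # q @ [(c, d)]" "b < n" "c < n"
    "a \<in> children (w \<circ> prod.swap) c b" "d \<in> children w b c"
    "apath b (tl p) d" "awalk_cost w (tl p) = spd w b d"
proof -
  from p have "p \<noteq> []" by (simp add: locally_shortest_path_def)
  then obtain e p' where "p = e # p'" by (cases p) auto
  moreover with len obtain q f where "p' = q @ [f]" by (cases p' rule: rev_cases) auto
  ultimately obtain a b c d where pq: "p = (a, b) # q @ [(c, d)]" by (cases e, cases f) auto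
  from p pq have path: "apath u p v" and sp1: "shortest_path w b (q @ [(c, d)]) v"
    and sp2: "shortest_path w u ((a, b) # q) c"
    by (auto simp: locally_shortest_path_def butlast_append)
  have walk: "awalk u p v" using path by (simp add: apath_def)
  with pq have ends: "u = a" "v = d" and arcs: "(a, b) \<in> E" "(c, d) \<in> E" and q: "awalk b q c"
    by (auto simp: awalk_simps dest: awalk_ends_eqD)
  have "b \<noteq> d"
    using sp1 ends by (auto simp: shortest_path_iff dest: apath_nonempty_ends)
  have "a \<noteq> c"
    using sp2 ends by (auto simp: shortest_path_iff dest: apath_nonempty_ends)
  have bc: "spd w b c \<le> awalk_cost w q" using q w by (rule spd_le_awalk[rotated])
  have "spd w b d = spd w b c + w (c, d)"
    using spd_triangle[OF w _ arcs(2), of b] arcs sp1 ends bc by (auto simp: shortest_path_iff)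
  then have 1: "d \<in> children w b c"
    using arcs \<open>b \<noteq> d\<close> by (auto simp: children_def)
  have wsw: "nonneg (w \<circ> prod.swap)"
    using w by (auto simp: nonneg_def)
  have "spd w a c = w (a, b) + spd w b c"
    using spd_triangle[OF wsw, of c b a] arcs sp2 ends bc by (auto simp: shortest_path_iff spd_swap)
  then have 2: "a \<in> children (w \<circ> prod.swap) c b"
    using arcs \<open>a \<noteq> c\<close> by (auto simp: children_def spd_swap)
  show ?thesis
    using that[OF pq] 1 2 arcs sp1 ends pq by (auto simp: shortest_path_iff)
qed

text \<open>By genericity the shortest path from \<open>b\<close> to \<open>d\<close> is unique, so
  a longer path is recovered from its four vertices as \<open>(a, b) # sp b d\<close>. Single arcs
  contribute at most \<open>n ^ 2\<close>.\<close>

lemma card_LSP_le: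
  assumes "generic w"
  shows "card (LSP w) \<le> n ^ 2 + (\<Sum>b<n. \<Sum>c<n. card (children (w \<circ> prod.swap) c b) * card (children w b c))"
proof -
  define sp where "sp b d = (SOME q. apath b q d \<and> awalk_cost w q = spd w b d)" for b d
  let ?S = "{..<n} \<times> {..<n}"
  let ?R = "SIGMA x:?S. children (w \<circ> prod.swap) (snd x) (fst x) \<times> children w (fst x) (snd x)"
  have fin: "finite (children v b c)" for v b c
    by (rule finite_subset[of _ "{..<n}"]) (auto simp: children_def)
  have "LSP w \<subseteq> (\<lambda>e. [e]) ` ?S \<union> (\<lambda>((b, c), (a, d)). (a, b) # sp b d) ` ?R"
  proof
    fix p assume "p \<in> LSP w"
    then obtain u v where p: "locally_shortest_path w u p v" by (auto simp: LSP_def)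
    show "p \<in> (\<lambda>e. [e]) ` ?S \<union> (\<lambda>((b, c), (a, d)). (a, b) # sp b d) ` ?R"
    proof (cases "length p = 1")
      case True
      then obtain e where e: "p = [e]" by (metis One_nat_def length_0_conv length_Suc_conv)
      with p have "e \<in> ?S" by (cases e) (auto simp: locally_shortest_path_def apath_simps)
      with e show ?thesis by blast
    next
      case False
      from LSP_long_decomp[OF generic_nonneg[OF assms] p this] obtain a b c d q
        where *: "p = (a, b) # q @ [(c, d)]" "b < n" "c < n"
          "a \<in> children (w \<circ> prod.swap) c b" "d \<in> children w b c"
          "apath b (tl p) d" "awalk_cost w (tl p) = spd w b d" by metis
      have "apath b (sp b d) d \<and> awalk_cost w (sp b d) = spd w b d"
        unfolding sp_def by (rule someI[of _ "tl p"]) (use * in auto)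
      then have "tl p = sp b d" using * assms unfolding generic_def by metis
      then have "p = (\<lambda>((b, c), (a, d)). (a, b) # sp b d) ((b, c), (a, d))"
        using * by simp
      moreover have "((b, c), (a, d)) \<in> ?R" using * by auto
      ultimately show ?thesis by blast
    qed
  qed
  then have "card (LSP w) \<le> card ((\<lambda>e. [e]) ` ?S \<union> (\<lambda>((b, c), (a, d)). (a, b) # sp b d) ` ?R)"
    by (intro card_mono) (auto intro!: finite_imageI fin)
  also have "\<dots> \<le> card ?S + card ?R"
    by (intro order.trans[OF card_Un_le] add_mono card_image_le finite_SigmaI) (auto intro: fin)
  also have "\<dots> = n ^ 2 + (\<Sum>b<n. \<Sum>c<n. card (children (w \<circ> prod.swap) c b) * card (children w b c))"
    using fin by (simp add: card_cartesian_product power2_eq_square sum.cartesian_product case_prod_unfold)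
  finally show ?thesis .
qed

end


section \<open>Resampling a single weight\<close>

definition unif01 :: "real measure" where
  "unif01 = uniform_measure lborel {0..1}"

lemma sets_unif01 [measurable_cong, simp]: "sets unif01 = sets borel"
  and space_unif01 [simp]: "space unif01 = UNIV"
  by (simp_all add: unif01_def)

lemma emeasure_unif01: "A \<in> sets borel \<Longrightarrow> emeasure unif01 A = emeasure lborel ({0..1} \<inter> A)"
  by (simp add: unif01_def divide_ennreal_def)

lemma prob_space_unif01: "prob_space unif01"
  unfolding unif01_def by (rule prob_space_uniform_measure) auto

lemma emeasure_unif01_Icc_le: "a \<le> b \<Longrightarrow> emeasure unif01 {a..b} \<le> ennreal (b - a)"
  using emeasure_mono[of "{0..1} \<inter> {a..b}" "{a..b}" lborel] by (simp add: emeasure_unif01)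

lemma emeasure_unif01_Icc:
  assumes "0 \<le> a" "a \<le> b" "b \<le> 1" shows "emeasure unif01 {a..b} = ennreal (b - a)"
proof -
  have "{0..1} \<inter> {a..b} = {a..b}" using assms by auto
  then show ?thesis using assms by (simp add: emeasure_unif01)
qed

lemma AE_unif01: "AE t in unif01. 0 < t \<and> t \<le> 1"
  unfolding unif01_def
proof (rule AE_uniform_measureI)
  show "AE t in lborel. t \<in> {0..1} \<longrightarrow> 0 < t \<and> t \<le> (1::real)"
    using AE_lborel_singleton[of "0::real"] by eventually_elim auto
qed simp

lemma nn_integral_unif01_le_const:
  assumes "\<And>t. 0 < t \<Longrightarrow> t \<le> 1 \<Longrightarrow> f t \<le> c" shows "(\<integral>\<^sup>+t. f t \<partial>unif01) \<le> c"
proof -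
  interpret prob_space unif01 by (rule prob_space_unif01)
  have "(\<integral>\<^sup>+t. f t \<partial>unif01) \<le> (\<integral>\<^sup>+t. c \<partial>unif01)"
    by (rule nn_integral_mono_AE) (use AE_unif01 assms in auto)
  then show ?thesis by (simp add: emeasure_space_1[simplified])
qed

context complete_network
begin

abbreviation weights_measure :: "(nat \<times> nat \<Rightarrow> real) measure" where
  "weights_measure \<equiv> Pi\<^sub>M E (\<lambda>_. unif01)"

sublocale U: finite_product_prob_space "\<lambda>_. unif01" E
proof -
  interpret product_prob_space "\<lambda>_. unif01" E
    by (intro product_prob_spaceI prob_space_unif01)
  show "finite_product_prob_space (\<lambda>_. unif01) E"
    by standard simp
qed

section \<open>Measurability of distances and children\<close>

lemma measurable_weight:
  "e \<in> E \<Longrightarrow> (\<lambda>w. w e) \<in> borel_measurable weights_measure"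
  using measurable_component_singleton[of e E "\<lambda>_. unif01"]
  by (simp add: measurable_cong_sets[OF refl sets_unif01])

lemma measurable_awalk_cost:
  "set p \<subseteq> E \<Longrightarrow> (\<lambda>w. awalk_cost w p) \<in> borel_measurable weights_measure"
proof (induction p)
  case (Cons e p)
  then have "(\<lambda>w. w e) \<in> borel_measurable weights_measure"
    "(\<lambda>w. awalk_cost w p) \<in> borel_measurable weights_measure"
    by (simp_all add: measurable_weight)
  then have "(\<lambda>w. w e + awalk_cost w p) \<in> borel_measurable weights_measure"
    by (rule borel_measurable_add)
  then show ?case by simp
qed simp

lemma measurable_spd: "(\<lambda>w. spd w u v) \<in> borel_measurable weights_measure"
  unfolding spd_def
proof (rule borel_measurable_Min[OF apaths_finite])
  fix p assume "p \<in> {p. apath u p v}"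
  then have "set p \<subseteq> E" by (auto simp: apath_def)
  then show "(\<lambda>w. awalk_cost w p) \<in> borel_measurable weights_measure"
    by (rule measurable_awalk_cost)
qed

lemma measurable_children:
  assumes "c < n" shows "Measurable.pred weights_measure (\<lambda>w. d \<in> children w b c)"
proof (cases "d < n \<and> d \<noteq> c")
  case True
  then have "(\<lambda>w. spd w b c + w (c, d)) \<in> borel_measurable weights_measure"
    using assms by (intro borel_measurable_add measurable_spd measurable_weight) auto
  note eq = borel_measurable_eq[OF measurable_spd[of b d] this]
  have "{w \<in> space weights_measure. d \<in> children w b c} = (if d = b then {}
      else {w \<in> space weights_measure. spd w b d = spd w b c + w (c, d)})"
    using True by (auto simp: children_def)
  then show ?thesis unfolding pred_def by (simp only: eq sets.empty_sets split: if_split) blast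
next
  case False
  then have "(\<lambda>w. d \<in> children w b c) = (\<lambda>_. False)"
    by (auto simp: children_def)
  then show ?thesis by (simp only: measurable_const UNIV_I space_count_space)
qed

lemma measurable_child_indicator:
  assumes "c < n"
  shows "(\<lambda>w. indicator (children w b c) d :: ennreal) \<in> borel_measurable weights_measure"
proof (rule borel_measurable_indicator')
  show "{w \<in> space weights_measure. d \<in> children w b c} \<in> sets weights_measure"
    using measurable_children[OF assms] unfolding pred_def .
qed

text \<open>\<open>ennreal\<close> maps negative reals to 0, so this is the positive part of the
  difference.\<close>

lemma measurable_delay:
  "(\<lambda>w. ennreal (spd w u v - spd w x y)) \<in> borel_measurable weights_measure"
  by (rule measurable_compose[OF borel_measurable_diff[OF measurable_spd measurable_spd] measurable_ennreal])

lemma AE_weights: "AE w in weights_measure. \<forall>e\<in>E. 0 < w e \<and> w e \<le> 1"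
  by (intro AE_finite_allI AE_PiM_component prob_space_unif01 AE_unif01) auto

text \<open>Fubini separates the coordinate \<open>e\<close>, so it suffices to compare the
  integrals over this one weight while all others are fixed at values in the almost sure
  range.\<close>

lemma nn_integral_resample_le:
  assumes e: "e \<in> E"
    and f [measurable]: "f \<in> borel_measurable weights_measure"
    and g [measurable]: "g \<in> borel_measurable weights_measure"
    and le: "\<And>w. (\<And>e. e \<in> E \<Longrightarrow> 0 < w e \<and> w e \<le> 1) \<Longrightarrow>
      (\<integral>\<^sup>+t. f (w(e := t)) \<partial>unif01) \<le> (\<integral>\<^sup>+t. g (w(e := t)) \<partial>unif01)"
  shows "(\<integral>\<^sup>+w. f w \<partial>weights_measure) \<le> (\<integral>\<^sup>+w. g w \<partial>weights_measure)"
proof -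
  have E: "insert e (E - {e}) = E" using e by auto
  have split: "(\<integral>\<^sup>+w. h w \<partial>weights_measure) =
      (\<integral>\<^sup>+w. (\<integral>\<^sup>+t. h (w(e := t)) \<partial>unif01) \<partial>Pi\<^sub>M (E - {e}) (\<lambda>_. unif01))"
    if "h \<in> borel_measurable weights_measure" for h
    using U.product_nn_integral_insert[of "E - {e}" e h] that unfolding E by simp
  have "AE w in Pi\<^sub>M (E - {e}) (\<lambda>_. unif01). \<forall>e'\<in>E - {e}. 0 < w e' \<and> w e' \<le> 1"
    by (intro AE_finite_allI AE_PiM_component prob_space_unif01 AE_unif01) auto
  then have "AE w in Pi\<^sub>M (E - {e}) (\<lambda>_. unif01).
      (\<integral>\<^sup>+t. f (w(e := t)) \<partial>unif01) \<le> (\<integral>\<^sup>+t. g (w(e := t)) \<partial>unif01)"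
  proof eventually_elim
    case (elim w)
    \<comment> \<open>The almost sure bounds cover only the arcs other than \<open>e\<close>. The
      value 1 at \<open>e\<close> completes them and is then overwritten by
      \<open>t\<close>.\<close>
    with le[of "w(e := 1)"] show ?case by auto
  qed
  then show ?thesis unfolding split[OF f] split[OF g] by (rule nn_integral_mono_AE)
qed

text \<open>Suppose that \<open>d\<close> is reached at time \<open>K\<close> after \<open>c\<close> when the arc \<open>(c, d)\<close> has the
  maximal weight \<open>1\<close>. Lowering this weight only decreases the delay, and the arc lies on a
  shortest path as soon as its weight is at most \<open>K\<close>, an event of probability \<open>K\<close>.\<close>

lemma delay_le_prob_child:
  assumes "b < n" "c < n" "d < n"
  shows "(\<integral>\<^sup>+w. ennreal (spd w b d - spd w b c) \<partial>weights_measure) \<le>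
    (\<integral>\<^sup>+w. indicator (children w b c) d \<partial>weights_measure)"
proof -
  consider "c = d" | "d = b" | "c \<noteq> d" "d \<noteq> b" by auto
  then show ?thesis
  proof cases
    \<comment> \<open>The root is nobody's child, so the right side is 0. The left side vanishes
      too, since no vertex is nearer to \<open>b\<close> than \<open>b\<close> itself.\<close>
    case 2
    have "AE w in weights_measure. ennreal (spd w b d - spd w b c) = 0"
      using AE_weights
    proof eventually_elim
      case (elim w)
      then have "nonneg w" by (auto simp: nonneg_def less_imp_le)
      moreover obtain p where "apath b p c" "awalk_cost w p = spd w b c"
        using spd_attained assms by metis
      ultimately have "0 \<le> spd w b c" by (metis awalk_cost_nonneg awalkI_apath)
      moreover have "spd w b b \<le> 0"
        using spd_le[of b "[]" b w] assms by (simp add: apath_Nil_iff)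
      ultimately show ?case using 2 by (simp add: ennreal_neg)
    qed
    then have "(\<integral>\<^sup>+w. ennreal (spd w b d - spd w b c) \<partial>weights_measure) = 0"
      using nn_integral_0_iff_AE[OF measurable_delay] by blast
    then show ?thesis by (simp only: zero_le)
  next
    case 3
    show ?thesis
    proof (rule nn_integral_resample_le[of "(c, d)"])
      fix w :: "nat \<times> nat \<Rightarrow> real"
      assume w: "\<And>e. e \<in> E \<Longrightarrow> 0 < w e \<and> w e \<le> 1"
      define wt where "wt t = w((c, d) := t)" for t
      define Y where "Y = spd w b c"
      define K where "K = spd (wt 1) b d - Y"
      have nn: "nonneg (wt t)" if "0 \<le> t" for t
        using w that by (auto simp: wt_def nonneg_def less_imp_le)
      have Y: "spd (wt t) b c = Y" for t by (simp add: wt_def Y_def)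
      have tri: "spd (wt t) b d \<le> Y + t" if "0 \<le> t" for t
        using spd_triangle[OF nn[OF that], of b c d] assms 3 Y by (simp add: wt_def)
      have upd: "spd (wt s) b d \<le> spd (wt t) b d" if "0 \<le> t" "spd (wt t) b d < Y + t" for s t
        using spd_upd_le[OF nn[OF that(1)], of b d c d s] that assms 3 Y by (simp add: wt_def)
      have "K \<le> 1" using tri[of 1] by (simp add: K_def)
      \<comment> \<open>Either the shortest path for weight 1 beats the detour through
        \<open>(c, d)\<close> and survives the change to \<open>t\<close>, or \<open>K = 1\<close>
        and the triangle inequality suffices.\<close>
      have le: "spd (wt t) b d - Y \<le> K" if "0 < t" "t \<le> 1" for t
        using upd[of 1 t] tri[of t] that by (force simp: K_def)
      \<comment> \<open>A cheaper path would survive raising the weight to 1, where it would cost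
        less than \<open>Y + K\<close>.\<close>
      have eq: "spd (wt t) b d = Y + t" if "0 \<le> t" "t \<le> K" for t
        using upd[of t 1] tri[of t] that by (force simp: K_def)
      have "(\<integral>\<^sup>+t. ennreal (spd (wt t) b d - spd (wt t) b c) \<partial>unif01) \<le> ennreal K"
        using le Y by (intro nn_integral_unif01_le_const) (simp add: ennreal_leI)
      also have "\<dots> \<le> (\<integral>\<^sup>+t. indicator {0..K} t \<partial>unif01)"
        using emeasure_unif01_Icc[of 0 K] \<open>K \<le> 1\<close> by (cases "0 \<le> K") (auto simp: ennreal_neg)
      also have "\<dots> \<le> (\<integral>\<^sup>+t. indicator (children (wt t) b c) d \<partial>unif01)"
      proof (rule nn_integral_mono)
        fix t
        show "indicator {0..K} t \<le> (indicator (children (wt t) b c) d :: ennreal)"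
          using eq[of t] Y assms 3 by (auto simp: indicator_def children_def wt_def)
      qed
      finally show "(\<integral>\<^sup>+t. ennreal (spd (w((c, d) := t)) b d - spd (w((c, d) := t)) b c) \<partial>unif01) \<le>
         (\<integral>\<^sup>+t. indicator (children (w((c, d) := t)) b c) d \<partial>unif01)"
        by (simp add: wt_def)
    qed (use assms 3 in \<open>simp_all only: arc_iff measurable_delay measurable_child_indicator\<close>, simp)
  qed (simp only: diff_self ennreal_0 nn_integral_const mult_zero_left zero_le)
qed

lemma measurable_siblings:
  assumes "c < n" "d < n" "d' < n"
  shows "(\<lambda>w. indicator {w. d \<in> children w b c \<and> d' \<in> children w b c \<and>
      w (c, d) \<le> w (c, d') \<and> w (c, d) \<le> 1 / 2} w :: ennreal) \<in> borel_measurable weights_measure"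
    (is "(\<lambda>w. indicator {w. ?Q w} w) \<in> _")
proof (cases "d \<noteq> c \<and> d' \<noteq> c")
  case True
  with assms have arcs: "(c, d) \<in> E" "(c, d') \<in> E" by auto
  have "{w \<in> space weights_measure. w \<in> {w. ?Q w}} \<in> sets weights_measure"
    using sets.Int[OF sets.Int[OF measurable_children[OF assms(1), of d b, unfolded pred_def]
          measurable_children[OF assms(1), of d' b, unfolded pred_def]]
        sets.Int[OF borel_measurable_le[OF measurable_weight[OF arcs(1)] measurable_weight[OF arcs(2)]]
          borel_measurable_le[OF measurable_weight[OF arcs(1)] borel_measurable_const[of "1 / 2"]]]]
    by (rule back_subst[of "\<lambda>A. A \<in> sets weights_measure"]) auto
  then show ?thesis by (rule borel_measurable_indicator')
next
  case False
  then have "(\<lambda>w. indicator {w. ?Q w} w) = (\<lambda>_. 0 :: ennreal)"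
    by (auto simp: children_def indicator_def fun_eq_iff)
  then show ?thesis by (simp only: borel_measurable_const)
qed

text \<open>Resample the weight \<open>t\<close> of \<open>(c, d')\<close> and let \<open>a\<close> be the weight of \<open>(c, d)\<close>. If the
  event happens for \<open>t = t\<^sub>0\<close>, then for all \<open>t \<ge> a\<close> the vertex \<open>d\<close> is still a child of \<open>c\<close> and
  the delay between \<open>d\<close> and \<open>d'\<close> is at least \<open>min t t\<^sub>0 - a\<close>. Since \<open>a \<le> 1 / 2\<close>, its mean is at
  least \<open>(t\<^sub>0 - a) / 8\<close>, so all such \<open>t\<^sub>0\<close> lie in an interval of length eight times the mean.\<close>

lemma prob_siblings_le_delay:
  assumes "b < n" "c < n" "d < n" "d' < n" "d \<noteq> d'"
  shows "(\<integral>\<^sup>+w. indicator {w. d \<in> children w b c \<and> d' \<in> children w b c \<and>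
             w (c, d) \<le> w (c, d') \<and> w (c, d) \<le> 1 / 2} w \<partial>weights_measure) \<le>
    (\<integral>\<^sup>+w. 8 * (indicator (children w b c) d * ennreal (spd w b d' - spd w b d)) \<partial>weights_measure)"
    (is "(\<integral>\<^sup>+w. indicator {w. ?Q w} w \<partial>_) \<le> (\<integral>\<^sup>+w. ?g w \<partial>_)")
proof (cases "d \<noteq> c \<and> d' \<noteq> c \<and> d \<noteq> b \<and> d' \<noteq> b")
  case False
  then have "\<not> ?Q w" for w by (auto simp: children_def)
  then show ?thesis by simp
next
  case True
  with assms have arcs: "(c, d) \<in> E" "(c, d') \<in> E" by auto
  have "(\<lambda>w. indicator {w. ?Q w} w :: ennreal) \<in> borel_measurable weights_measure"
    by (rule measurable_siblings[OF assms(2-4)])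
  moreover have "?g \<in> borel_measurable weights_measure"
    by (rule borel_measurable_times_ennreal[OF borel_measurable_const
          borel_measurable_times_ennreal[OF measurable_child_indicator[OF assms(2)] measurable_delay]])
  ultimately show ?thesis
  proof (rule nn_integral_resample_le[of "(c, d')", rotated 1])
    fix w :: "nat \<times> nat \<Rightarrow> real"
    assume w: "\<And>e. e \<in> E \<Longrightarrow> 0 < w e \<and> w e \<le> 1"
    define wt where "wt t = w((c, d') := t)" for t
    define Y where "Y = spd w b c"
    define a where "a = w (c, d)"
    define G where "G = (\<integral>\<^sup>+t. ?g (wt t) \<partial>unif01)"
    have a: "0 < a" using w arcs by (simp add: a_def)
    have nn: "nonneg (wt t)" if "0 \<le> t" for t
      using w that by (auto simp: wt_def nonneg_def less_imp_le)
    have Y: "spd (wt t) b c = Y" for t by (simp add: wt_def Y_def)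
    have wt: "wt t (c, d') = t" "wt t (c, d) = a" for t
      using assms by (auto simp: wt_def a_def)
    have upd: "spd (wt s) b v \<le> spd (wt t) b v" if "0 \<le> t" "v < n" "spd (wt t) b v < Y + t" for s t v
      using spd_upd_le[OF nn[OF that(1)], of b v c d' s] that assms arcs Y by (simp add: wt_def)
    have key: "ennreal (t\<^sub>0 - a) \<le> G" if t\<^sub>0: "0 < t\<^sub>0" "t\<^sub>0 \<le> 1" and Q: "?Q (wt t\<^sub>0)" for t\<^sub>0
    proof -
      have Q': "spd (wt t\<^sub>0) b d = Y + a" "spd (wt t\<^sub>0) b d' = Y + t\<^sub>0" "a \<le> t\<^sub>0" "a \<le> 1 / 2"
        using Q by (auto simp: children_def Y wt)
      \<comment> \<open>For \<open>t\<close> above this midpoint the delay is at least half of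
        \<open>t\<^sub>0 - a\<close>. As \<open>m \<le> 3 / 4\<close>, such \<open>t\<close> have
        probability at least 1/4, and the factor 8 makes up for both losses.\<close>
      define m where "m = (a + t\<^sub>0) / 2"
      have m: "0 \<le> m" "a \<le> m" "m \<le> t\<^sub>0" "m \<le> 3 / 4" using a t\<^sub>0 Q' by (auto simp: m_def)
      have ge: "ennreal (4 * (t\<^sub>0 - a)) \<le> ?g (wt t)" if "m \<le> t" for t
      proof -
        have "spd (wt t) b d \<le> Y + a"
          using spd_triangle[OF nn, of t b c d] assms arcs m that Y wt by simp
        \<comment> \<open>Here, and for \<open>d'\<close> below, a path cheaper than the claimed
          bound costs less than \<open>Y + t\<close>. It would survive the change from
          \<open>t\<close> to \<open>t\<^sub>0\<close> and contradict the distances in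
          \<open>Q'\<close>.\<close>
        moreover have "Y + a \<le> spd (wt t) b d"
          using upd[of t d t\<^sub>0] Q' m that assms by force
        ultimately have d: "spd (wt t) b d = Y + a" by simp
        then have "d \<in> children (wt t) b c" using True assms by (simp add: children_def Y wt)
        moreover have "Y + m \<le> spd (wt t) b d'"
          using upd[of t d' t\<^sub>0] Q' m that assms by force
        then have "(t\<^sub>0 - a) / 2 \<le> spd (wt t) b d' - spd (wt t) b d"
          using d by (simp add: m_def field_simps)
        then have "8 * ennreal ((t\<^sub>0 - a) / 2) \<le> 8 * ennreal (spd (wt t) b d' - spd (wt t) b d)"
          by (intro mult_left_mono ennreal_leI) auto
        moreover have "8 * ennreal ((t\<^sub>0 - a) / 2) = ennreal (4 * (t\<^sub>0 - a))"
          using Q' by (simp flip: ennreal_numeral ennreal_mult')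
        ultimately show ?thesis by simp
      qed
      have "ennreal (t\<^sub>0 - a) \<le> ennreal (4 * (t\<^sub>0 - a) * (1 - m))"
        using m Q' mult_left_mono[of "1 / 4" "1 - m" "4 * (t\<^sub>0 - a)"] by (intro ennreal_leI) simp
      also have "\<dots> = ennreal (4 * (t\<^sub>0 - a)) * emeasure unif01 {m..1}"
        using m Q' by (subst emeasure_unif01_Icc) (auto simp: ennreal_mult')
      also have "\<dots> = (\<integral>\<^sup>+t. ennreal (4 * (t\<^sub>0 - a)) * indicator {m..1} t \<partial>unif01)"
        by (subst nn_integral_cmult_indicator) auto
      also have "\<dots> \<le> G"
        unfolding G_def using ge by (intro nn_integral_mono) (auto simp: indicator_def)
      finally show ?thesis .
    qed
    have "(\<integral>\<^sup>+t. indicator {w. ?Q w} (wt t) \<partial>unif01) \<le> G"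
    proof (cases G)
      case (real K)
      have "AE t in unif01. indicator {w. ?Q w} (wt t) \<le> (indicator {a..a + K} t :: ennreal)"
        using AE_unif01
      proof eventually_elim
        case (elim t)
        show ?case
        proof (cases "?Q (wt t)")
          case True
          then have "a \<le> t" by (simp add: wt)
          moreover have "t - a \<le> K" using key[of t] elim True real by simp
          ultimately show ?thesis by (simp add: indicator_def)
        qed simp
      qed
      then have "(\<integral>\<^sup>+t. indicator {w. ?Q w} (wt t) \<partial>unif01) \<le> (\<integral>\<^sup>+t. indicator {a..a + K} t \<partial>unif01)"
        by (rule nn_integral_mono_AE)
      also have "\<dots> \<le> ennreal K" using emeasure_unif01_Icc_le[of a "a + K"] real by simp
      finally show ?thesis using real by simp
    qed simp
    then show "(\<integral>\<^sup>+t. indicator {w. ?Q w} (w((c, d') := t)) \<partial>unif01) \<le>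
      (\<integral>\<^sup>+t. ?g (w((c, d') := t)) \<partial>unif01)"
      by (simp add: G_def wt_def)
  qed (use arcs in simp)
qed


section \<open>Generic weights\<close>

text \<open>A simple path contains only one arc leaving its first vertex, so the set of arcs
  determines the first arc and, inductively, the path.\<close>

lemma apath_eqI: "apath u p v \<Longrightarrow> apath u q v \<Longrightarrow> set p = set q \<Longrightarrow> p = q"
proof (induction p arbitrary: u q)
  case (Cons e p)
  then obtain f q' where q: "q = f # q'" by (cases q) auto
  have notin: "(fst e, x) \<notin> set r" if "apath u (g # r) v" "fst e = u" for g r x
  proof
    assume "(fst e, x) \<in> set r"
    then have "u \<in> set (awalk_verts (snd g) r)"
      using that awalk_verts_arc1[of "(fst e, x)" r "snd g"] by simp
    then show False using that by (auto simp: apath_Cons_iff)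
  qed
  have u: "fst e = u" "fst f = u" using Cons.prems q by (auto simp: apath_Cons_iff)
  have "e \<in> set q" using Cons.prems by auto
  then have "e = f"
    using notin[of f q' "snd e"] Cons.prems q u by auto
  moreover have "e \<notin> set p" "f \<notin> set q'"
    using notin[of e p "snd e"] notin[of f q' "snd f"] Cons.prems q u by (metis prod.collapse)+
  moreover have "apath (snd e) p v" "apath (snd f) q' v"
    using Cons.prems q by (auto simp: apath_Cons_iff)
  ultimately show ?case
    using Cons.IH[of "snd e" q'] Cons.prems(3) q by (metis insert_ident list.set(2))
qed (auto simp: set_empty2)

text \<open>A simple path uses an arc at most once. With the other weights fixed, equal costs
  therefore pin the weight of \<open>e\<close> to the single value \<open>x\<close>, a null
  event.\<close>

lemma AE_awalk_cost_neq:
  assumes p: "apath u p v" and q: "apath u' q v'" and e: "e \<in> set p" "e \<notin> set q"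
  shows "AE w in weights_measure. awalk_cost w p \<noteq> awalk_cost w q"
proof -
  let ?C = "{w. awalk_cost w p = awalk_cost w q}"
  have "set p \<subseteq> E" "set q \<subseteq> E" using p q by (auto simp: apath_def)
  then have meas: "(\<lambda>w. indicator ?C w :: ennreal) \<in> borel_measurable weights_measure"
    using borel_measurable_eq[OF measurable_awalk_cost measurable_awalk_cost, of p q]
    by (intro borel_measurable_indicator') (simp only: mem_Collect_eq)
  have "distinct p" using p by (auto simp: apath_def intro: distinct_verts_imp_distinct)
  then obtain p1 p2 where p12: "p = p1 @ e # p2" "e \<notin> set p1" "e \<notin> set p2"
    using e by (auto dest: split_list)
  have "(\<integral>\<^sup>+w. indicator ?C w \<partial>weights_measure) \<le> (\<integral>\<^sup>+w. 0 \<partial>weights_measure)"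
  proof (rule nn_integral_resample_le[of e, OF _ meas borel_measurable_const])
    fix w :: "nat \<times> nat \<Rightarrow> real"
    define x where "x = awalk_cost w q - awalk_cost w p1 - awalk_cost w p2"
    have "w(e := t) \<in> ?C \<longleftrightarrow> t \<in> {x..x}" for t
      using p12 e by (auto simp: x_def)
    then have "(\<integral>\<^sup>+t. indicator ?C (w(e := t)) \<partial>unif01) = (\<integral>\<^sup>+t. indicator {x..x} t \<partial>unif01)"
      unfolding indicator_def by (simp only:)
    also have "\<dots> \<le> 0"
      using emeasure_unif01_Icc_le[of x x] by simp
    finally show "(\<integral>\<^sup>+t. indicator ?C (w(e := t)) \<partial>unif01) \<le> (\<integral>\<^sup>+t. 0 \<partial>unif01)"
      by simp
  qed (use p e in \<open>auto simp: apath_def\<close>)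
  then have "(\<integral>\<^sup>+w. indicator ?C w \<partial>weights_measure) = 0"
    by (simp only: nn_integral_const mult_zero_left le_zero_eq)
  then have "AE w in weights_measure. indicator ?C w = (0 :: ennreal)"
    using nn_integral_0_iff_AE[OF meas] by blast
  then show ?thesis by eventually_elim (auto simp: indicator_def)
qed

text \<open>There are finitely many simple paths, and two different ones with common ends differ in
  some arc by \<open>apath_eqI\<close>.\<close>

lemma AE_generic: "AE w in weights_measure. generic w"
proof -
  have "AE w in weights_measure. \<forall>x\<in>{(u, p, v). apath u p v}. \<forall>y\<in>{(u, p, v). apath u p v}.
      fst x = fst y \<longrightarrow> snd (snd x) = snd (snd y) \<longrightarrow> fst (snd x) \<noteq> fst (snd y) \<longrightarrow>
      awalk_cost w (fst (snd x)) \<noteq> awalk_cost w (fst (snd y))"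
  proof (intro AE_finite_allI apaths_finite_triple)
    fix x y assume "x \<in> {(u, p, v). apath u p v}" "y \<in> {(u, p, v). apath u p v}"
    then obtain u p v u' q v' where xy: "x = (u, p, v)" "y = (u', q, v')" "apath u p v" "apath u' q v'"
      by auto
    show "AE w in weights_measure. fst x = fst y \<longrightarrow> snd (snd x) = snd (snd y) \<longrightarrow>
      fst (snd x) \<noteq> fst (snd y) \<longrightarrow> awalk_cost w (fst (snd x)) \<noteq> awalk_cost w (fst (snd y))"
    proof (cases "u = u' \<and> v = v' \<and> p \<noteq> q")
      case True
      then have "set p \<noteq> set q" using apath_eqI xy by blast
      then consider e where "e \<in> set p" "e \<notin> set q" | e where "e \<in> set q" "e \<notin> set p" by blast
      then have "AE w in weights_measure. awalk_cost w p \<noteq> awalk_cost w q"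
      proof cases
        case 1 then show ?thesis using AE_awalk_cost_neq xy by blast
      next
        case 2
        then have "AE w in weights_measure. awalk_cost w q \<noteq> awalk_cost w p"
          using AE_awalk_cost_neq xy by blast
        then show ?thesis by eventually_elim simp
      qed
      then show ?thesis by eventually_elim (simp add: xy)
    qed (auto simp: xy)
  qed
  with AE_weights show ?thesis
    unfolding generic_def by eventually_elim fastforce
qed

text \<open>Almost surely \<open>d\<close> has at most one parent, so at most one indicator is
  nonzero. The factor \<open>h\<close> makes room for delays.\<close>

lemma sum_parents_le:
  assumes "b < n" and h: "h \<in> borel_measurable weights_measure"
  shows "(\<Sum>c<n. \<integral>\<^sup>+w. indicator (children w b c) d * h w \<partial>weights_measure) \<le>
    (\<integral>\<^sup>+w. h w \<partial>weights_measure)"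
proof -
  have "(\<Sum>c<n. \<integral>\<^sup>+w. indicator (children w b c) d * h w \<partial>weights_measure) =
      (\<integral>\<^sup>+w. (\<Sum>c<n. indicator (children w b c) d * h w) \<partial>weights_measure)"
    using h by (intro nn_integral_sum[symmetric] borel_measurable_times_ennreal measurable_child_indicator)
      (simp_all only: lessThan_iff)
  also have "\<dots> \<le> (\<integral>\<^sup>+w. h w \<partial>weights_measure)"
  proof (rule nn_integral_mono_AE)
    show "AE w in weights_measure. (\<Sum>c<n. indicator (children w b c) d * h w) \<le> h w"
      using AE_generic
    proof eventually_elim
      case (elim w)
      show ?case
      proof (cases "\<exists>c<n. d \<in> children w b c")
        case True
        then obtain a where a: "a < n" "d \<in> children w b a" by blast
        then have "(\<Sum>c<n. indicator (children w b c) d * h w) = (\<Sum>c<n. if c = a then h w else 0)"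
          using parent_unique[OF elim assms(1)] by (intro sum.cong) (auto simp: indicator_def)
        then show ?thesis using a by simp
      qed (auto intro!: sum_nonpos simp: indicator_def)
    qed
  qed
  finally show ?thesis .
qed

lemma sum_prob_parents_le:
  assumes "b < n"
  shows "(\<Sum>c<n. \<integral>\<^sup>+w. indicator (children w b c) d \<partial>weights_measure) \<le> 1"
proof -
  have "(\<Sum>c<n. \<integral>\<^sup>+w. indicator (children w b c) d * 1 \<partial>weights_measure) \<le>
    (\<integral>\<^sup>+w. 1 \<partial>weights_measure)"
    by (rule sum_parents_le[OF assms borel_measurable_const])
  then show ?thesis by (simp only: mult_1_right nn_integral_const U.P.emeasure_space_1)
qed


section \<open>Long arcs\<close>

text \<open>A product of these 0-1 values indicates that all the detours are blocked. Two arcs of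
  weight at most 1/4 beat one arc of weight above 1/2.\<close>

definition blocked :: "(nat \<times> nat \<Rightarrow> real) \<Rightarrow> nat \<Rightarrow> nat \<Rightarrow> nat \<Rightarrow> ennreal" where
  "blocked w c d m = (if w (c, m) \<le> 1 / 4 \<and> w (m, d) \<le> 1 / 4 then 0 else 1)"

lemma measurable_blocked:
  assumes "c < n" "d < n" "m < n" "m \<noteq> c" "m \<noteq> d"
  shows "(\<lambda>w. blocked w c d m) \<in> borel_measurable weights_measure"
proof -
  have arcs: "(c, m) \<in> E" "(m, d) \<in> E" using assms by auto
  have "{w \<in> space weights_measure. w (c, m) \<le> 1 / 4 \<and> w (m, d) \<le> 1 / 4} \<in> sets weights_measure"
    using sets.Int[OF borel_measurable_le[OF measurable_weight[OF arcs(1)] borel_measurable_const[of "1 / 4"]]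
      borel_measurable_le[OF measurable_weight[OF arcs(2)] borel_measurable_const[of "1 / 4"]]]
    by (rule back_subst[of "\<lambda>A. A \<in> sets weights_measure"]) auto
  then show ?thesis
    unfolding blocked_def by (intro measurable_If borel_measurable_const)
qed

text \<open>Detours through different vertices share no arc, and each one is open with probability
  1/16. Independence is obtained by resampling the two arcs at \<open>m\<close> in turn, which
  leaves the remaining product \<open>H\<close> unchanged.\<close>

lemma prob_all_blocked_le:
  assumes cd: "c < n" "d < n"
    and "finite M" "M \<subseteq> {..<n} - {c, d}"
  shows "(\<integral>\<^sup>+w. (\<Prod>m\<in>M. blocked w c d m) \<partial>weights_measure) \<le> ennreal (15 / 16) ^ card M"
  using assms(3,4)
proof (induction M rule: finite_induct)
  case empty
  show ?case by (simp add: U.P.emeasure_space_1)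
next
  case (insert m M)
  then have m: "m < n" "m \<noteq> c" "m \<noteq> d" and arcs: "(c, m) \<in> E" "(m, d) \<in> E"
    using cd by auto
  define H where "H w = (\<Prod>m\<in>M. blocked w c d m)" for w
  \<comment> \<open>Bounds the probability that the detour is blocked, given the weight of
    \<open>(c, m)\<close>.\<close>
  define \<psi> :: "real \<Rightarrow> ennreal" where "\<psi> x = (if x \<le> 1 / 4 then ennreal (3 / 4) else 1)" for x
  have [measurable]: "\<psi> \<in> borel_measurable borel" unfolding \<psi>_def by measurable
  have H: "H \<in> borel_measurable weights_measure"
    unfolding H_def using insert cd by (intro borel_measurable_prod_ennreal measurable_blocked) auto
  have \<psi>: "(\<lambda>w. \<psi> (w (c, m))) \<in> borel_measurable weights_measure"
    by (rule measurable_compose[OF measurable_weight[OF arcs(1)]]) measurable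
  have H_upd: "H (w((c, m) := t)) = H w" "H (w((m, d) := t)) = H w" for w t
    unfolding H_def blocked_def using insert m by (auto intro!: prod.cong)
  have "(\<integral>\<^sup>+w. blocked w c d m * H w \<partial>weights_measure) \<le> (\<integral>\<^sup>+w. \<psi> (w (c, m)) * H w \<partial>weights_measure)"
  proof (rule nn_integral_resample_le[OF arcs(2)])
    fix w :: "nat \<times> nat \<Rightarrow> real"
    have bnd: "(\<integral>\<^sup>+t. (if w (c, m) \<le> 1 / 4 \<and> t \<le> 1 / 4 then 0 else 1) \<partial>unif01) \<le> \<psi> (w (c, m))"
    proof (cases "w (c, m) \<le> 1 / 4")
      case True
      have "(\<integral>\<^sup>+t. (if w (c, m) \<le> 1 / 4 \<and> t \<le> 1 / 4 then 0 else 1) \<partial>unif01) \<le>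
          (\<integral>\<^sup>+t. indicator {1 / 4..1} t \<partial>unif01)"
        by (rule nn_integral_mono_AE) (use AE_unif01 True in \<open>auto simp: indicator_def\<close>)
      then show ?thesis using True emeasure_unif01_Icc[of "1 / 4" 1] by (simp add: \<psi>_def)
    next
      case False
      then show ?thesis by (intro nn_integral_unif01_le_const) (auto simp: \<psi>_def)
    qed
    have "(\<integral>\<^sup>+t. blocked (w((m, d) := t)) c d m * H w \<partial>unif01) =
        (\<integral>\<^sup>+t. (if w (c, m) \<le> 1 / 4 \<and> t \<le> 1 / 4 then 0 else 1) \<partial>unif01) * H w"
      using m by (subst nn_integral_multc[symmetric]) (auto simp: blocked_def)
    also have "\<dots> \<le> \<psi> (w (c, m)) * H w" by (rule mult_right_mono[OF bnd zero_le])
    finally have "(\<integral>\<^sup>+t. blocked (w((m, d) := t)) c d m * H w \<partial>unif01) \<le> \<psi> (w (c, m)) * H w" .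
    then show "(\<integral>\<^sup>+t. blocked (w((m, d) := t)) c d m * H (w((m, d) := t)) \<partial>unif01) \<le>
        (\<integral>\<^sup>+t. \<psi> ((w((m, d) := t)) (c, m)) * H (w((m, d) := t)) \<partial>unif01)"
      using m prob_space.emeasure_space_1[OF prob_space_unif01] by (simp add: H_upd)
  qed (rule borel_measurable_times_ennreal[OF measurable_blocked[OF cd m] H]
      borel_measurable_times_ennreal[OF \<psi> H])+
  also have "\<dots> \<le> (\<integral>\<^sup>+w. ennreal (15 / 16) * H w \<partial>weights_measure)"
  proof (rule nn_integral_resample_le[OF arcs(1)])
    fix w :: "nat \<times> nat \<Rightarrow> real"
    \<comment> \<open>The step function is at most 3/4 on the unit interval plus 1/4 on
      \<open>{1 / 4..1}\<close>, and \<open>3/4 + 1/4 * 3/4 = 15/16\<close>.\<close>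
    have "(\<integral>\<^sup>+t. \<psi> t \<partial>unif01) \<le>
        (\<integral>\<^sup>+t. ennreal (3 / 4) * indicator {0..1} t + ennreal (1 / 4) * indicator {1 / 4..1} t \<partial>unif01)"
    proof (rule nn_integral_mono_AE)
      show "AE t in unif01. \<psi> t \<le>
          ennreal (3 / 4) * indicator {0..1} t + ennreal (1 / 4) * indicator {1 / 4..1} t"
        using AE_unif01
        by eventually_elim (auto simp: \<psi>_def indicator_def simp flip: ennreal_plus)
    qed
    also have "\<dots> = ennreal (3 / 4) * emeasure unif01 {0..1} + ennreal (1 / 4) * emeasure unif01 {1 / 4..1}"
      by (simp add: nn_integral_add nn_integral_cmult)
    also have "\<dots> = ennreal (15 / 16)"
      by (simp add: emeasure_unif01_Icc flip: ennreal_mult ennreal_plus)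
    finally have bnd: "(\<integral>\<^sup>+t. \<psi> t \<partial>unif01) \<le> ennreal (15 / 16)" .
    have "(\<integral>\<^sup>+t. \<psi> t * H w \<partial>unif01) = (\<integral>\<^sup>+t. \<psi> t \<partial>unif01) * H w"
      by (rule nn_integral_multc) simp
    also have "\<dots> \<le> ennreal (15 / 16) * H w" by (rule mult_right_mono[OF bnd zero_le])
    finally have "(\<integral>\<^sup>+t. \<psi> t * H w \<partial>unif01) \<le> ennreal (15 / 16) * H w" .
    then show "(\<integral>\<^sup>+t. \<psi> ((w((c, m) := t)) (c, m)) * H (w((c, m) := t)) \<partial>unif01) \<le>
        (\<integral>\<^sup>+t. ennreal (15 / 16) * H (w((c, m) := t)) \<partial>unif01)"
      using prob_space.emeasure_space_1[OF prob_space_unif01] by (simp add: H_upd)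
  qed (rule borel_measurable_times_ennreal[OF \<psi> H]
      borel_measurable_times_ennreal[OF borel_measurable_const H])+
  also have "\<dots> = ennreal (15 / 16) * (\<integral>\<^sup>+w. H w \<partial>weights_measure)"
    by (rule nn_integral_cmult[OF H])
  also have "\<dots> \<le> ennreal (15 / 16) * ennreal (15 / 16) ^ card M"
    unfolding H_def using insert by (intro mult_left_mono) auto
  finally show ?case using insert by (simp only: H_def prod.insert card_insert_disjoint power_Suc not_False_eq_True)
qed

text \<open>An open detour through \<open>m\<close> would reach \<open>d\<close> within 1/2 after
  \<open>c\<close>, earlier than the arc \<open>(c, d)\<close> does.\<close>

lemma long_child_detours_blocked:
  assumes "nonneg w" "b < n" "c < n" "d \<in> children w b c" "1 / 2 < w (c, d)"
    and m: "m < n" "m \<noteq> c" "m \<noteq> d"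
  shows "blocked w c d m = 1"
proof -
  have "d < n" using assms by (simp add: children_def)
  then have "spd w b d \<le> spd w b m + w (m, d)" "spd w b m \<le> spd w b c + w (c, m)"
    using assms by (auto intro!: spd_triangle)
  then show ?thesis using assms by (auto simp: children_def blocked_def)
qed

lemma measurable_long_child:
  assumes "c < n"
  shows "(\<lambda>w. indicator {w. d \<in> children w b c \<and> 1 / 2 < w (c, d)} w :: ennreal)
    \<in> borel_measurable weights_measure"
    (is "(\<lambda>w. indicator {w. ?Q w} w) \<in> _")
proof (cases "d < n \<and> d \<noteq> c")
  case True
  with assms have arc: "(c, d) \<in> E" by auto
  have "{w \<in> space weights_measure. w \<in> {w. ?Q w}} \<in> sets weights_measure"
    using sets.Int[OF measurable_children[OF assms(1), of d b, unfolded pred_def]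
        borel_measurable_less[OF borel_measurable_const[of "1 / 2"] measurable_weight[OF arc]]]
    by (rule back_subst[of "\<lambda>A. A \<in> sets weights_measure"]) auto
  then show ?thesis by (rule borel_measurable_indicator')
next
  case False
  then have "(\<lambda>w. indicator {w. ?Q w} w) = (\<lambda>_. 0 :: ennreal)"
    by (auto simp: children_def indicator_def fun_eq_iff)
  then show ?thesis by (simp only: borel_measurable_const)
qed

lemma prob_long_child_le:
  assumes "b < n" "c < n"
  shows "(\<integral>\<^sup>+w. indicator {w. d \<in> children w b c \<and> 1 / 2 < w (c, d)} w \<partial>weights_measure) \<le>
    ennreal (15 / 16) ^ (n - 2)"
proof (cases "d < n \<and> d \<noteq> c")
  case True
  let ?M = "{..<n} - {c, d}"
  have "(\<integral>\<^sup>+w. indicator {w. d \<in> children w b c \<and> 1 / 2 < w (c, d)} w \<partial>weights_measure) \<le>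
      (\<integral>\<^sup>+w. (\<Prod>m\<in>?M. blocked w c d m) \<partial>weights_measure)"
  proof (rule nn_integral_mono_AE)
    show "AE w in weights_measure. indicator {w. d \<in> children w b c \<and> 1 / 2 < w (c, d)} w \<le>
        (\<Prod>m\<in>?M. blocked w c d m)"
      using AE_weights
    proof eventually_elim
      case (elim w)
      then have "nonneg w" by (auto simp: nonneg_def less_imp_le)
      then show ?case
        using long_child_detours_blocked[of w b c d] assms by (auto simp: indicator_def)
    qed
  qed
  also have "\<dots> \<le> ennreal (15 / 16) ^ card ?M"
    using assms True by (intro prob_all_blocked_le) auto
  also have "card ?M = n - 2" using assms True by (simp add: card_Diff_subset)
  finally show ?thesis .
next
  case False
  then have "indicator {w. d \<in> children w b c \<and> 1 / 2 < w (c, d)} w = (0 :: ennreal)" for w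
    by (auto simp: children_def indicator_def)
  then show ?thesis by (simp only: nn_integral_const mult_zero_left zero_le)
qed


section \<open>The expected number of locally shortest paths\<close>

text \<open>Points of the product space are \<open>undefined\<close> outside \<open>E\<close>, and
  \<open>E\<close> is closed under swapping. The restricted form fits the reindexing theorem for
  product measures.\<close>

lemma swap_arcs_eq_restrict:
  assumes "w \<in> space weights_measure"
  shows "w \<circ> prod.swap = (\<lambda>e\<in>E. w (prod.swap e))"
proof
  fix e :: "nat \<times> nat"
  show "(w \<circ> prod.swap) e = (\<lambda>e\<in>E. w (prod.swap e)) e"
    using assms by (cases e) (auto simp: space_PiM PiE_def extensional_def)
qed

lemma measurable_swap_arcs:
  "(\<lambda>w. w \<circ> prod.swap) \<in> measurable weights_measure weights_measure"
proof -
  have "(\<lambda>w. \<lambda>e\<in>E. w (prod.swap e)) \<in> measurable weights_measure weights_measure"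
  proof (rule measurable_restrict)
    fix e assume "e \<in> E"
    then have "prod.swap e \<in> E" by (cases e) auto
    then show "(\<lambda>w. w (prod.swap e)) \<in> measurable weights_measure unif01"
      by (rule measurable_component_singleton)
  qed
  then show ?thesis by (subst measurable_cong[OF swap_arcs_eq_restrict])
qed

lemma distr_swap_arcs:
  "distr weights_measure weights_measure (\<lambda>w. w \<circ> prod.swap) = weights_measure"
proof -
  have "distr weights_measure weights_measure (\<lambda>w. w \<circ> prod.swap) =
      distr weights_measure weights_measure (\<lambda>w. \<lambda>e\<in>E. w (prod.swap e))"
    by (intro distr_cong refl swap_arcs_eq_restrict)
  also have "\<dots> = weights_measure"
    by (rule distr_PiM_reindex[OF prob_space_unif01]) (auto simp: inj_on_def)
  finally show ?thesis .
qed

lemma nn_integral_swap_arcs: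
  assumes "h \<in> borel_measurable weights_measure"
  shows "(\<integral>\<^sup>+w. h (w \<circ> prod.swap) \<partial>weights_measure) = (\<integral>\<^sup>+w. h w \<partial>weights_measure)"
  using nn_integral_distr[OF measurable_swap_arcs, of h] assms by (simp only: distr_swap_arcs)

section \<open>Second moments of the numbers of children\<close>

lemma of_nat_card_children:
  "(of_nat (card (children w b c)) :: ennreal) = (\<Sum>d<n. indicator (children w b c) d)"
proof -
  have "children w b c = {..<n} \<inter> children w b c" by (auto simp: children_def)
  then show ?thesis by (simp add: indicator_def sum.If_cases)
qed

lemma of_nat_card_children_sq:
  "(of_nat (card (children w b c) ^ 2) :: ennreal) =
    (\<Sum>d<n. \<Sum>d'<n. indicator (children w b c) d * indicator (children w b c) d')"
  by (subst of_nat_power, subst of_nat_card_children, subst power2_eq_square, rule sum_product)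

lemma measurable_card_children_sq:
  assumes "c < n"
  shows "(\<lambda>w. of_nat (card (children w b c) ^ 2) :: ennreal) \<in> borel_measurable weights_measure"
  unfolding of_nat_card_children_sq using assms
  by (intro borel_measurable_times_ennreal borel_measurable_sum measurable_child_indicator)

text \<open>If the lighter of the two arcs weighs at most 1/2, the pair is a sibling pair in one of
  the two orders; otherwise both arcs are long.\<close>

lemma prob_two_children_le:
  assumes "b < n" "c < n" "d < n" "d' < n" "d \<noteq> d'"
  defines "D \<equiv> \<lambda>d d'. \<integral>\<^sup>+w. indicator (children w b c) d * ennreal (spd w b d' - spd w b d) \<partial>weights_measure"
    and "\<rho> \<equiv> ennreal (15 / 16) ^ (n - 2)"
  shows "(\<integral>\<^sup>+w. indicator (children w b c) d * indicator (children w b c) d' \<partial>weights_measure) \<le>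
    8 * (D d d' + D d' d) + 2 * \<rho>"
proof -
  let ?I = "\<lambda>d d' w. indicator {w. d \<in> children w b c \<and> d' \<in> children w b c \<and>
      w (c, d) \<le> w (c, d') \<and> w (c, d) \<le> 1 / 2} w :: ennreal"
  let ?L = "\<lambda>d w. indicator {w. d \<in> children w b c \<and> 1 / 2 < w (c, d)} w :: ennreal"
  have meas: "?I d d' \<in> borel_measurable weights_measure" "?I d' d \<in> borel_measurable weights_measure"
    "?L d \<in> borel_measurable weights_measure" "?L d' \<in> borel_measurable weights_measure"
    using assms(1-4) by (simp_all only: measurable_siblings measurable_long_child)
  have I: "(\<integral>\<^sup>+w. ?I x y w \<partial>weights_measure) \<le> 8 * D x y" if "x < n" "y < n" "x \<noteq> y" for x y
  proof -
    have "(\<lambda>w. indicator (children w b c) x * ennreal (spd w b y - spd w b x)) \<in> borel_measurable weights_measure"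
      by (rule borel_measurable_times_ennreal[OF measurable_child_indicator[OF assms(2)] measurable_delay])
    from nn_integral_cmult[OF this, of 8] show ?thesis
      using prob_siblings_le_delay[OF assms(1,2) that] unfolding D_def by (simp only:)
  qed
  have "(\<integral>\<^sup>+w. indicator (children w b c) d * indicator (children w b c) d' \<partial>weights_measure) \<le>
      (\<integral>\<^sup>+w. (?I d d' w + ?I d' d w) + (?L d w + ?L d' w) \<partial>weights_measure)"
    by (rule nn_integral_mono) (auto simp: indicator_def)
  also have "\<dots> = ((\<integral>\<^sup>+w. ?I d d' w \<partial>weights_measure) + (\<integral>\<^sup>+w. ?I d' d w \<partial>weights_measure)) +
      ((\<integral>\<^sup>+w. ?L d w \<partial>weights_measure) + (\<integral>\<^sup>+w. ?L d' w \<partial>weights_measure))"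
    by (simp only: nn_integral_add meas borel_measurable_add)
  also have "\<dots> \<le> (8 * D d d' + 8 * D d' d) + (\<rho> + \<rho>)"
    unfolding \<rho>_def using I[of d d'] I[of d' d] assms(1-5) by (intro add_mono prob_long_child_le) auto
  finally show ?thesis by (simp only: mult_2 distrib_left)
qed

definition sum_sq_children :: "(nat \<times> nat \<Rightarrow> real) \<Rightarrow> nat" where
  "sum_sq_children w = (\<Sum>b<n. \<Sum>c<n. card (children w b c) ^ 2)"

lemma nn_integral_sum_sq_children_le:
  "(\<integral>\<^sup>+w. of_nat (sum_sq_children w) \<partial>weights_measure) \<le>
    of_nat n * (17 * of_nat n + 2 * of_nat n ^ 3 * ennreal (15 / 16) ^ (n - 2))"
proof -
  define P where "P b c d = (\<integral>\<^sup>+w. indicator (children w b c) d \<partial>weights_measure)" for b c d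
  define D where "D b c d d' = (\<integral>\<^sup>+w. indicator (children w b c) d *
      ennreal (spd w b d' - spd w b d) \<partial>weights_measure)" for b c d d'
  define \<rho> where "\<rho> = ennreal (15 / 16) ^ (n - 2)"
  let ?ind = "\<lambda>b c d w. indicator (children w b c) d :: ennreal"
  have P: "(\<Sum>c<n. \<Sum>d<n. P b c d) \<le> of_nat n" if "b < n" for b
  proof -
    have "(\<Sum>d<n. \<Sum>c<n. P b c d) \<le> of_nat (card {..<n}) * 1"
      unfolding P_def by (intro sum_bounded_above sum_prob_parents_le that)
    then show ?thesis by (subst sum.swap) simp
  qed
  have D: "(\<Sum>c<n. \<Sum>d<n. \<Sum>d'<n. D b c d d') \<le> of_nat n" if b: "b < n" for b
  proof -
    \<comment> \<open>The sum over \<open>c\<close> is moved inside, where uniqueness of the parent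
      of \<open>d\<close> removes the indicator. The remaining mean delay is at most the probability
      that \<open>d'\<close> is a child of \<open>d\<close>.\<close>
    have "(\<Sum>c<n. \<Sum>d<n. \<Sum>d'<n. D b c d d') = (\<Sum>d<n. \<Sum>c<n. \<Sum>d'<n. D b c d d')"
      by (rule sum.swap)
    also have "\<dots> = (\<Sum>d<n. \<Sum>d'<n. \<Sum>c<n. D b c d d')"
      by (intro sum.cong refl sum.swap)
    also have "\<dots> \<le> (\<Sum>d<n. \<Sum>d'<n. P b d d')"
    proof (intro sum_mono)
      fix d d' assume "d \<in> {..<n}" "d' \<in> {..<n}"
      then have "d < n" "d' < n" by simp_all
      have "(\<Sum>c<n. D b c d d') \<le> (\<integral>\<^sup>+w. ennreal (spd w b d' - spd w b d) \<partial>weights_measure)"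
        unfolding D_def by (rule sum_parents_le[OF b measurable_delay])
      also have "\<dots> \<le> P b d d'"
        unfolding P_def by (rule delay_le_prob_child) fact+
      finally show "(\<Sum>c<n. D b c d d') \<le> P b d d'" .
    qed
    also have "\<dots> \<le> of_nat n" using b by (rule P)
    finally show ?thesis .
  qed
  have card_sq: "(\<integral>\<^sup>+w. of_nat (card (children w b c) ^ 2) \<partial>weights_measure) =
      (\<Sum>d<n. \<Sum>d'<n. \<integral>\<^sup>+w. ?ind b c d w * ?ind b c d' w \<partial>weights_measure)" if c: "c < n" for b c
  proof -
    have meas: "(\<lambda>w. ?ind b c d w * ?ind b c d' w) \<in> borel_measurable weights_measure" for d d'
      using c by (intro borel_measurable_times_ennreal measurable_child_indicator)
    have "(\<integral>\<^sup>+w. of_nat (card (children w b c) ^ 2) \<partial>weights_measure) =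
        (\<integral>\<^sup>+w. (\<Sum>d<n. \<Sum>d'<n. ?ind b c d w * ?ind b c d' w) \<partial>weights_measure)"
      by (simp only: of_nat_card_children_sq)
    also have "\<dots> = (\<Sum>d<n. \<integral>\<^sup>+w. (\<Sum>d'<n. ?ind b c d w * ?ind b c d' w) \<partial>weights_measure)"
      by (intro nn_integral_sum borel_measurable_sum meas)
    also have "\<dots> = (\<Sum>d<n. \<Sum>d'<n. \<integral>\<^sup>+w. ?ind b c d w * ?ind b c d' w \<partial>weights_measure)"
      by (intro sum.cong refl nn_integral_sum meas)
    finally show ?thesis .
  qed
  have pair: "(\<integral>\<^sup>+w. ?ind b c d w * ?ind b c d' w \<partial>weights_measure) \<le>
      (if d = d' then P b c d else 0) + (8 * (D b c d d' + D b c d' d) + 2 * \<rho>)"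
    if "b < n" "c < n" "d < n" "d' < n" for b c d d'
  proof (cases "d = d'")
    case True
    then have "(\<integral>\<^sup>+w. ?ind b c d w * ?ind b c d' w \<partial>weights_measure) = P b c d"
      unfolding P_def by (intro nn_integral_cong) (simp add: indicator_def)
    then show ?thesis unfolding if_P[OF True] by (simp only: add_increasing2 zero_le order_refl)
  next
    case False
    from prob_two_children_le[OF that this] False show ?thesis
      unfolding D_def \<rho>_def by (simp only: if_False add_0)
  qed
  \<comment> \<open>The constant is 1 for the diagonal \<open>d = d'\<close> plus 8 for each order
    of a sibling pair. Each of the \<open>n ^ 3\<close> triples adds
    \<open>2 * \<rho>\<close>.\<close>
  have row: "(\<Sum>c<n. \<integral>\<^sup>+w. of_nat (card (children w b c) ^ 2) \<partial>weights_measure) \<le>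
      17 * of_nat n + 2 * of_nat n ^ 3 * \<rho>" if b: "b < n" for b
  proof -
    have "(\<Sum>c<n. \<integral>\<^sup>+w. of_nat (card (children w b c) ^ 2) \<partial>weights_measure) =
        (\<Sum>c<n. \<Sum>d<n. \<Sum>d'<n. \<integral>\<^sup>+w. ?ind b c d w * ?ind b c d' w \<partial>weights_measure)"
      by (intro sum.cong refl card_sq) simp
    also have "\<dots> \<le> (\<Sum>c<n. \<Sum>d<n. \<Sum>d'<n. (if d = d' then P b c d else 0) +
        (8 * (D b c d d' + D b c d' d) + 2 * \<rho>))"
      using b by (intro sum_mono pair) auto
    also have "\<dots> = (\<Sum>c<n. \<Sum>d<n. P b c d) + (8 * ((\<Sum>c<n. \<Sum>d<n. \<Sum>d'<n. D b c d d') +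
        (\<Sum>c<n. \<Sum>d<n. \<Sum>d'<n. D b c d' d)) + of_nat n * (of_nat n * (of_nat n * (2 * \<rho>))))"
      by (simp add: sum.distrib flip: sum_distrib_left)
    also have "(\<Sum>c<n. \<Sum>d<n. \<Sum>d'<n. D b c d' d) = (\<Sum>c<n. \<Sum>d<n. \<Sum>d'<n. D b c d d')"
      by (intro sum.cong refl sum.swap)
    also have "(\<Sum>c<n. \<Sum>d<n. P b c d) + (8 * ((\<Sum>c<n. \<Sum>d<n. \<Sum>d'<n. D b c d d') +
        (\<Sum>c<n. \<Sum>d<n. \<Sum>d'<n. D b c d d')) + of_nat n * (of_nat n * (of_nat n * (2 * \<rho>)))) \<le>
        of_nat n + (8 * (of_nat n + of_nat n) + of_nat n * (of_nat n * (of_nat n * (2 * \<rho>))))"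
      using P[OF b] D[OF b] by (intro add_mono mult_left_mono order_refl) auto
    also have "\<dots> = (1 + (8 + 8)) * of_nat n + 2 * of_nat n ^ 3 * \<rho>"
      by (simp only: distrib_left distrib_right mult_1_left power3_eq_cube ac_simps)
    also have "1 + (8 + 8) = (17 :: ennreal)" by simp
    finally show ?thesis .
  qed
  have "(\<integral>\<^sup>+w. of_nat (sum_sq_children w) \<partial>weights_measure) =
      (\<integral>\<^sup>+w. (\<Sum>b<n. \<Sum>c<n. of_nat (card (children w b c) ^ 2)) \<partial>weights_measure)"
    by (simp only: sum_sq_children_def of_nat_sum)
  also have "\<dots> = (\<Sum>b<n. \<integral>\<^sup>+w. (\<Sum>c<n. of_nat (card (children w b c) ^ 2)) \<partial>weights_measure)"
    by (intro nn_integral_sum borel_measurable_sum measurable_card_children_sq) (simp only: lessThan_iff)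
  also have "\<dots> = (\<Sum>b<n. \<Sum>c<n. \<integral>\<^sup>+w. of_nat (card (children w b c) ^ 2) \<partial>weights_measure)"
    by (intro sum.cong refl nn_integral_sum measurable_card_children_sq) (simp only: lessThan_iff)
  also have "\<dots> \<le> of_nat (card {..<n}) * (17 * of_nat n + 2 * of_nat n ^ 3 * \<rho>)"
    by (intro sum_bounded_above row) simp
  finally show ?thesis by (simp add: \<rho>_def)
qed

lemma measurable_sum_sq_children:
  "(\<lambda>w. of_nat (sum_sq_children w) :: ennreal) \<in> borel_measurable weights_measure"
  unfolding sum_sq_children_def of_nat_sum
  by (intro borel_measurable_sum measurable_card_children_sq) (simp only: lessThan_iff)

lemma measurable_sum_sq_children_swap:
  "(\<lambda>w. of_nat (sum_sq_children (w \<circ> prod.swap)) :: ennreal) \<in> borel_measurable weights_measure"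
  by (rule measurable_compose[OF measurable_swap_arcs measurable_sum_sq_children])

lemma card_LSP_le_sum_sq_children:
  assumes "generic w"
  shows "card (LSP w) \<le> n ^ 2 + (sum_sq_children w + sum_sq_children (w \<circ> prod.swap))"
proof -
  have *: "x * y \<le> y ^ 2 + x ^ 2" for x y :: nat
  proof (cases "x \<le> y")
    case True
    then have "x * y \<le> y * y" by simp
    then show ?thesis unfolding power2_eq_square by linarith
  next
    case False
    then have "x * y \<le> x * x" by simp
    then show ?thesis unfolding power2_eq_square by linarith
  qed
  have "card (LSP w) \<le> n ^ 2 +
      (\<Sum>b<n. \<Sum>c<n. card (children (w \<circ> prod.swap) c b) * card (children w b c))"
    by (rule card_LSP_le[OF assms])
  also have "\<dots> \<le> n ^ 2 + (\<Sum>b<n. \<Sum>c<n. card (children w b c) ^ 2 + card (children (w \<circ> prod.swap) c b) ^ 2)"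
    by (intro add_left_mono sum_mono *)
  also have "\<dots> = n ^ 2 + (sum_sq_children w + (\<Sum>b<n. \<Sum>c<n. card (children (w \<circ> prod.swap) c b) ^ 2))"
    by (simp add: sum_sq_children_def sum.distrib)
  also have "(\<Sum>b<n. \<Sum>c<n. card (children (w \<circ> prod.swap) c b) ^ 2) = sum_sq_children (w \<circ> prod.swap)"
    unfolding sum_sq_children_def by (rule sum.swap)
  finally show ?thesis .
qed

lemma nn_integral_card_LSP_le:
  "(\<integral>\<^sup>+w. of_nat (card (LSP w)) \<partial>weights_measure) \<le>
    of_nat n ^ 2 + 2 * (of_nat n * (17 * of_nat n + 2 * of_nat n ^ 3 * ennreal (15 / 16) ^ (n - 2)))"
proof -
  let ?S = "\<lambda>w. of_nat (sum_sq_children w) :: ennreal"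
  have "(\<integral>\<^sup>+w. of_nat (card (LSP w)) \<partial>weights_measure) \<le>
      (\<integral>\<^sup>+w. of_nat n ^ 2 + (?S w + ?S (w \<circ> prod.swap)) \<partial>weights_measure)"
  proof (rule nn_integral_mono_AE)
    show "AE w in weights_measure. of_nat (card (LSP w)) \<le> of_nat n ^ 2 + (?S w + ?S (w \<circ> prod.swap))"
      using AE_generic
    proof eventually_elim
      case (elim w)
      from of_nat_mono[OF card_LSP_le_sum_sq_children[OF this], where 'a = ennreal]
      show ?case by (simp only: of_nat_add of_nat_power)
    qed
  qed
  also have "\<dots> = of_nat n ^ 2 + ((\<integral>\<^sup>+w. ?S w \<partial>weights_measure) + (\<integral>\<^sup>+w. ?S (w \<circ> prod.swap) \<partial>weights_measure))"
    by (simp only: nn_integral_add measurable_sum_sq_children measurable_sum_sq_children_swap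
        borel_measurable_add borel_measurable_const nn_integral_const U.P.emeasure_space_1 mult_1_right)
  also have "(\<integral>\<^sup>+w. ?S (w \<circ> prod.swap) \<partial>weights_measure) = (\<integral>\<^sup>+w. ?S w \<partial>weights_measure)"
    by (rule nn_integral_swap_arcs[OF measurable_sum_sq_children])
  also have "(\<integral>\<^sup>+w. ?S w \<partial>weights_measure) + (\<integral>\<^sup>+w. ?S w \<partial>weights_measure) \<le>
      2 * (of_nat n * (17 * of_nat n + 2 * of_nat n ^ 3 * ennreal (15 / 16) ^ (n - 2)))"
    by (subst mult_2) (rule add_mono[OF nn_integral_sum_sq_children_le nn_integral_sum_sq_children_le])
  finally show ?thesis by (simp add: add_left_mono)
qed

section \<open>Measurability and integrability of the count\<close>

text \<open>For a fixed list and fixed ends, being a simple path does not depend on the weights;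
  only two equations between costs and distances remain.\<close>

lemma sets_mem_LSP: "{w \<in> space weights_measure. p \<in> LSP w} \<in> sets weights_measure"
proof -
  let ?P = "\<lambda>u v. p \<noteq> [] \<and> apath u p v \<and> apath (snd (hd p)) (tl p) v \<and> apath u (butlast p) (fst (last p))"
  let ?C = "\<lambda>q u v. {w \<in> space weights_measure. awalk_cost w q = spd w u v}"
  have C: "?C q u v \<in> sets weights_measure" if "apath u q v" for q u v
    using that by (intro borel_measurable_eq measurable_spd measurable_awalk_cost) (auto simp: apath_def)
  have eq: "{w \<in> space weights_measure. p \<in> LSP w} =
      (\<Union>u<n. \<Union>v<n. if ?P u v then ?C (tl p) (snd (hd p)) v \<inter> ?C (butlast p) u (fst (last p)) else {})"
    using apath_vertices
    by (fastforce simp: LSP_def locally_shortest_path_def shortest_path_iff split: if_splits)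
  show ?thesis
    unfolding eq
  proof (intro sets.finite_UN finite_lessThan)
    fix u v
    show "(if ?P u v then ?C (tl p) (snd (hd p)) v \<inter> ?C (butlast p) u (fst (last p)) else {})
        \<in> sets weights_measure"
      using C by (cases "?P u v") (simp_all only: if_True if_False sets.empty_sets sets.Int simp_thms)
  qed
qed

text \<open>A finite superset independent of \<open>w\<close> makes the count a finite sum of
  indicators and bounds it.\<close>

lemma LSP_subset_apaths: "LSP w \<subseteq> fst ` snd ` {(u, p, v). apath u p v}"
  by (force simp: LSP_def locally_shortest_path_def)

lemma measurable_card_LSP: "(\<lambda>w. real (card (LSP w))) \<in> borel_measurable weights_measure"
proof -
  let ?Q = "fst ` snd ` {(u, p, v). apath u p v}"
  have "(\<lambda>w. \<Sum>p\<in>?Q. indicator (LSP w) p :: real) \<in> borel_measurable weights_measure"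
    by (intro borel_measurable_sum borel_measurable_indicator' sets_mem_LSP)
  moreover have "real (card (LSP w)) = (\<Sum>p\<in>?Q. indicator (LSP w) p)" for w
  proof -
    have "finite ?Q" by (intro finite_imageI apaths_finite_triple)
    moreover have "LSP w = ?Q \<inter> LSP w" using LSP_subset_apaths by blast
    ultimately show ?thesis by (simp add: indicator_def sum.If_cases)
  qed
  ultimately show ?thesis by (simp only:)
qed

lemma integrable_card_LSP: "integrable weights_measure (\<lambda>w. real (card (LSP w)))"
proof (rule U.P.integrable_const_bound[OF _ measurable_card_LSP])
  have "card (LSP w) \<le> card (fst ` snd ` {(u, p, v). apath u p v})" for w
    by (intro card_mono finite_imageI apaths_finite_triple LSP_subset_apaths)
  then show "AE w in weights_measure. norm (real (card (LSP w))) \<le>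
      real (card (fst ` snd ` {(u, p, v). apath u p v}))"
    by (intro AE_I2) (simp only: real_norm_def abs_of_nat of_nat_le_iff)
qed

lemma integral_card_LSP_ge: "real (n * (n - 1)) \<le> (\<integral>w. real (card (LSP w)) \<partial>weights_measure)"
  by (rule U.P.integral_ge_const[OF integrable_card_LSP])
    (intro AE_I2 of_nat_mono card_LSP_ge)

lemma integral_card_LSP_le:
  "(\<integral>w. real (card (LSP w)) \<partial>weights_measure) \<le>
    real n ^ 2 + 2 * (real n * (17 * real n + 2 * real n ^ 3 * (15 / 16) ^ (n - 2)))"
proof -
  have "ennreal (\<integral>w. real (card (LSP w)) \<partial>weights_measure) = (\<integral>\<^sup>+w. ennreal (real (card (LSP w))) \<partial>weights_measure)"
    by (rule nn_integral_eq_integral[OF integrable_card_LSP, symmetric]) (intro AE_I2 of_nat_0_le_iff)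
  also have "\<dots> \<le> of_nat n ^ 2 + 2 * (of_nat n * (17 * of_nat n + 2 * of_nat n ^ 3 * ennreal (15 / 16) ^ (n - 2)))"
    using nn_integral_card_LSP_le by (simp only: ennreal_of_nat_eq_real_of_nat)
  also have "\<dots> = ennreal (real n ^ 2 + 2 * (real n * (17 * real n + 2 * real n ^ 3 * (15 / 16) ^ (n - 2))))"
    by (simp add: ennreal_of_nat_eq_real_of_nat ennreal_power ennreal_mult)
  finally show ?thesis by (subst (asm) ennreal_le_iff) auto
qed

section \<open>Transfer to arbitrary probability spaces\<close>

text \<open>The joint law of the independent weights is the product measure. The bound
  \<open>2 \<le> n\<close> makes \<open>E\<close> nonempty, as the characterisation of independence
  by the joint law requires.\<close>

lemma expectation_card_LSP:
  fixes M :: "'a measure" and W :: "nat \<times> nat \<Rightarrow> 'a \<Rightarrow> real"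
  assumes "prob_space M" and n: "2 \<le> n"
    and indep: "prob_space.indep_vars M (\<lambda>_. borel) W E"
    and unif: "\<And>e. e \<in> E \<Longrightarrow> distr M borel (W e) = uniform_measure lborel {0..1}"
  shows "prob_space.expectation M (\<lambda>\<omega>. real (card (LSP (\<lambda>e. W e \<omega>)))) =
    (\<integral>w. real (card (LSP w)) \<partial>weights_measure)"
proof -
  interpret M: prob_space M by fact
  let ?X = "\<lambda>\<omega>. \<lambda>e\<in>E. W e \<omega>"
  have "(0, 1) \<in> E" using n by simp
  then have ne: "E \<noteq> {}" by blast
  have rv: "W e \<in> borel_measurable M" if "e \<in> E" for e
    using indep that unfolding M.indep_vars_def by blast
  have sets_eq: "sets (Pi\<^sub>M E (\<lambda>_. borel)) = sets weights_measure"
    by (intro sets_PiM_cong refl) simp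
  have X: "?X \<in> measurable M weights_measure"
    using rv by (intro measurable_restrict) (simp only: measurable_cong_sets[OF refl sets_unif01])
  have "distr M weights_measure ?X = distr M (Pi\<^sub>M E (\<lambda>_. borel)) ?X"
    by (rule distr_cong) (simp_all only: sets_eq)
  also have "\<dots> = Pi\<^sub>M E (\<lambda>e. distr M borel (W e))"
    using indep M.indep_vars_iff_distr_eq_PiM'[OF ne, where M' = "\<lambda>_. borel" and X = W] rv by blast
  also have "\<dots> = weights_measure"
    by (intro PiM_cong refl) (simp only: unif unif01_def)
  finally have distr: "distr M weights_measure ?X = weights_measure" .
  have "(\<integral>w. real (card (LSP w)) \<partial>weights_measure) = (\<integral>w. real (card (LSP w)) \<partial>distr M weights_measure ?X)"
    by (simp only: distr)
  also have "\<dots> = (\<integral>\<omega>. real (card (LSP (?X \<omega>))) \<partial>M)"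
    by (rule integral_distr[OF X measurable_card_LSP])
  also have "\<dots> = (\<integral>\<omega>. real (card (LSP (\<lambda>e. W e \<omega>))) \<partial>M)"
    by (intro arg_cong[of _ _ "integral\<^sup>L M"] ext arg_cong[of _ _ "\<lambda>A. real (card A)"] LSP_cong) simp
  finally show ?thesis by (rule sym)
qed

end

theorem theorem15:
  fixes M :: "nat \<Rightarrow> 'a measure"
    and W :: "nat \<Rightarrow> nat \<times> nat \<Rightarrow> 'a \<Rightarrow> real"
  assumes prob: "\<And>n. prob_space (M n)"
    and indep: "\<And>n. prob_space.indep_vars (M n) (\<lambda>_. borel) (W n) (arcs (complete_dgraph n))"
    and unif: "\<And>n e. e \<in> arcs (complete_dgraph n) \<Longrightarrow>
                 distr (M n) borel (W n e) = uniform_measure lborel {0..1}"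
  shows "(\<lambda>n. prob_space.expectation (M n)
            (\<lambda>\<omega>. real (card (wf_digraph.LSP (complete_dgraph n) (\<lambda>e. W n e \<omega>)))))
         \<in> \<Theta>(\<lambda>n. real n ^ 2)"
    (is "?f \<in> _")
proof -
  have lower: "real n * real (n - 1) \<le> ?f n"
    and upper: "?f n \<le> real n ^ 2 + 2 * (real n * (17 * real n + 2 * real n ^ 3 * (15 / 16) ^ (n - 2)))"
    if "2 \<le> n" for n
    using complete_network.integral_card_LSP_ge[of n] complete_network.integral_card_LSP_le[of n]
      complete_network.expectation_card_LSP[OF prob that indep unif] by (simp_all only: of_nat_mult)
  have "?f \<in> \<Omega>(\<lambda>n. real n ^ 2)"
  proof (rule landau_omega.bigI[of "1 / 2"])
    show "\<forall>\<^sub>F n in sequentially. norm (?f n) \<ge> 1 / 2 * norm (real n ^ 2)"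
      using eventually_ge_at_top[of 2]
    proof eventually_elim
      case (elim n)
      then have "real n ^ 2 \<le> 2 * (real n * real (n - 1))"
        by (simp add: power2_eq_square of_nat_diff algebra_simps)
      then show ?case using lower[OF elim] by simp
    qed
  qed simp
  moreover have "?f \<in> O(\<lambda>n. real n ^ 2)"
  \<comment> \<open>The constant is \<open>1 + 34 + 1\<close>: the last summand absorbs the
    exponentially small term, which is eventually at most \<open>n ^ 2\<close>.\<close>
  proof (rule landau_o.bigI[of 36])
    have "\<forall>\<^sub>F n in sequentially. 4 * real n ^ 4 * ((15 / 16) ^ n * (16 / 15) ^ 2) \<le> real n ^ 2"
      by real_asymp
    then show "\<forall>\<^sub>F n in sequentially. norm (?f n) \<le> 36 * norm (real n ^ 2)"
      using eventually_ge_at_top[of 2]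
    proof eventually_elim
      case (elim n)
      have "(15 / 16 :: real) ^ (n - 2) = (15 / 16) ^ n * (16 / 15) ^ 2"
        using elim by (simp add: power_diff power_divide)
      then have "2 * (real n * (17 * real n + 2 * real n ^ 3 * (15 / 16) ^ (n - 2))) =
          34 * real n ^ 2 + 4 * real n ^ 4 * ((15 / 16) ^ n * (16 / 15) ^ 2)"
        by (simp add: algebra_simps power2_eq_square power3_eq_cube power4_eq_xxxx)
      moreover have "0 \<le> ?f n" using lower[OF elim(2)] by (rule order_trans[rotated]) simp
      ultimately show ?case using upper[OF elim(2)] elim by simp
    qed
  qed simp
  ultimately show ?thesis by (rule bigthetaI[rotated])
qed

end
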